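(* Let $0<\rho\le 1$, let $\Omega\subset\mathbb{R}^N$ be a bounded domain with smooth boundary, and let the elliptic operator $A(x,D)$ of order $m=2l$ and the boundary operators $B_1,\dots,B_l$ (as described in the context) satisfy condition $(A)$. Let $f(x,t)\in C(\overline{\Omega}\times(0,\infty))$ and $\varphi\in C(\overline{\Omega})$. Then the initial-boundary value problem $$\partial_t^\rho u(x,t)+A(x,D)u(x,t)=f(x,t),\quad x\in\Omega,\ t>0,$$ $$\lim_{t\to 0}\partial_t^{\rho-1}u(x,t)=\varphi(x),\quad x\in\Omega,$$ $$B_ju(x,t)=0,\quad j=1,\dots,l,\ x\in\partial\Omega,$$ has at most one regular solution.
   Context: **Operators.** $\Omega\subset\mathbb{R}^N$ is a bounded domain with smooth boundary $\partial\Omega$. $D=(D_1,\dots,D_N)$ with $D_j=\frac{1}{i}\frac{\partial}{\partial x_j}$, and $D^\alpha=D_1^{\alpha_1}\cdots D_N^{\alpha_N}$ for a multi-index $\alpha$. $A(x,D)=\sum_{|\alpha|\le m}a_\alpha(x)D^\alpha$ is a positive formally selfadjoint (symmetric) differential operator of order $m=2l$ with sufficiently smooth coefficients, elliptic in the sense that $\sum_{|\alpha|=m}a_\alpha(x)\xi^\alpha>0$ for all $x\in\Omega$ and all $\xi\in\mathbb{R}^N$, $\xi\ne0$. The boundary operators are $B_j u=\sum_{|\alpha|\le m_j}b_{\alpha,j}(x)D^\alpha u$ with $0\le m_j\le m-1$, $j=1,\dots,l$, where the $b_{\alpha,j}$ are given functions. **Condition (A).** The boundary $\partial\Omega$ and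 the coefficients of $A(x,D)$ and $B_1,\dots,B_l$ satisfy Agmon's conditions for a regular elliptic boundary value problem: $\partial\Omega$ and the coefficients are sufficiently smooth (up to the boundary); $A$ is elliptic up to the boundary; the system $\{B_j\}$ is normal (the orders $m_j$ are distinct and $\partial\Omega$ is noncharacteristic for each $B_j$); and the $B_j$ satisfy the complementing (Lopatinskii–Shapiro) condition with respect to $A$. Moreover, the operator $A$ in $L_2(\Omega)$ acting as $Ag(x)=A(x,D)g(x)$ on $D(A)=\{g\in C^m(\overline\Omega): B_jg=0 \text{ on }\partial\Omega,\ j=1,\dots,l\}$ is symmetric and positive. These conditions guarantee compactness of the inverse operator, i.e. the spectral problem $A(x,D)v=\lambda v$ in $\Omega$, $B_jv=0$ on $\partial\Omega$ ($j=1,\dots,l$) has a complete orthonormal system of eigenfunctions $\{v_k\}_{k\ge1}$ in $L_2(\Omega)$ and a countable set of corresponding positive eigenvalues $\lambda_k$. **Fractional derivatives (Riemann–Liouville, in $t$).** For $\rho<0$, $\partial_t^\rho h(t)=\frac{1}{\Gamma(-\rho)}\int_0^t\frac{h(\xi)}{(t-\xi)^{\rho+1}}\,d\xi$, $t>0$, provided the right-hand side exists; $\partial_t^0$ is the identity. For $0<\rho\le1$, $\partial_t^\rho h(t)=\frac{d}{dt}\partial_t^{\rho-1}h(t)$; in particular $\partial_t^1=\frac{d}{dt}$. **Regular solution.** A function $u(x,t)$ such that $\partial_t^\rho u(x,t)$ and $A(x,D)u(x,t)$ belong to $C(\overline\Omega\times(0,\infty))$ (this is understood as a requirement of continuity in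 the closed domain of all the derivatives appearing in the equation), $\partial_t^{\rho-1}u(x,t)\in C(\overline\Omega\times[0,\infty))$, and the equation, the initial condition and the boundary conditions are satisfied in the classical sense. *)

theory Defs
  imports "HOL-Analysis.Analysis" "HOL-Computational_Algebra.Computational_Algebra"
begin

section \<open>Multi-indices and partial derivatives\<close>

text \<open>
  The coordinates of \<open>\<real>\<^sup>N\<close> are indexed by a finite linearly ordered type; the order only fixes
  the meaning of \<open>D\<^sup>\<alpha> = D\<^sub>1\<^bsup>\<alpha>1\<^esup> \<dots> D\<^sub>N\<^bsup>\<alpha>N\<^esup>\<close>.  For every \<open>N \<ge> 1\<close> there is such a type, e.g. the
  numeral type \<open>N\<close>.
\<close>

definition mlen :: "('n::finite \<Rightarrow> nat) \<Rightarrow> nat" where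
  "mlen \<alpha> = (\<Sum>i\<in>UNIV. \<alpha> i)"

definition partial_deriv ::
  "'n::finite \<Rightarrow> (real^'n \<Rightarrow> 'b::real_normed_vector) \<Rightarrow> real^'n \<Rightarrow> 'b" where
  "partial_deriv i g x = vector_derivative (\<lambda>s. g (x + s *\<^sub>R axis i 1)) (at 0)"

definition D_op :: "'n::finite \<Rightarrow> (real^'n \<Rightarrow> complex) \<Rightarrow> real^'n \<Rightarrow> complex" where
  "D_op i g x = (1 / \<i>) * partial_deriv i g x"

definition D_multi ::
  "('n::{finite,linorder} \<Rightarrow> nat) \<Rightarrow> ((real, 'n) vec \<Rightarrow> complex) \<Rightarrow> (real, 'n) vec \<Rightarrow> complex" where
  "D_multi \<alpha> g = foldr (\<lambda>i. D_op i ^^ \<alpha> i) (sorted_list_of_set UNIV) g"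

text \<open>\<open>Ck_on k S\<close> is the class \<open>C\<^sup>k(S)\<close>; it is meant for open \<open>S\<close>.\<close>

primrec Ck_on ::
  "nat \<Rightarrow> (real^'n::finite) set \<Rightarrow> (real^'n \<Rightarrow> 'b::real_normed_vector) \<Rightarrow> bool" where
  "Ck_on 0 S g \<longleftrightarrow> continuous_on S g"
| "Ck_on (Suc k) S g \<longleftrightarrow> continuous_on S g \<and>
     (\<forall>i. (\<forall>x\<in>S. (\<lambda>s. g (x + s *\<^sub>R axis i 1)) differentiable (at 0)) \<and>
          Ck_on k S (partial_deriv i g))"

text \<open>
  \<open>D\<^sup>\<alpha> g\<close> on the closure of the open set \<open>\<Omega>\<close>: at a boundary point it is the limit of the
  values inside \<open>\<Omega>\<close>, i.e. the value of the continuous extension whenever there is one.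
\<close>

definition D_closed ::
  "(real, 'n::{finite,linorder}) vec set \<Rightarrow> ('n \<Rightarrow> nat) \<Rightarrow> ((real, 'n) vec \<Rightarrow> complex) \<Rightarrow> (real, 'n) vec \<Rightarrow> complex"
  where
  "D_closed \<Omega> \<alpha> g x = (if x \<in> \<Omega> then D_multi \<alpha> g x else Lim (at x within \<Omega>) (D_multi \<alpha> g))"

text \<open>
  The class \<open>C\<^sup>k(closure \<Omega>)\<close>: all derivatives of order at most \<open>k\<close> extend continuously to the
  closure.  If an unspecified value of \<open>Lim\<close> occurred in \<open>D_closed\<close>, then \<open>D_closed\<close> would not be
  continuous there, so the continuity condition does force the existence of the limits.
\<close>

definition Ck_closure ::
  "nat \<Rightarrow> (real, 'n::{finite,linorder}) vec set \<Rightarrow> ((real, 'n) vec \<Rightarrow> complex) \<Rightarrow> bool" where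
  "Ck_closure k \<Omega> g \<longleftrightarrow> Ck_on k \<Omega> g \<and> continuous_on (closure \<Omega>) g \<and>
     (\<forall>\<alpha>. mlen \<alpha> \<le> k \<longrightarrow> continuous_on (closure \<Omega>) (D_closed \<Omega> \<alpha> g))"

text \<open>The class \<open>C\<^sup>k(\<partial>\<Omega>)\<close>: restrictions to the boundary of \<open>C\<^sup>k\<close> functions.\<close>

definition Ck_boundary ::
  "nat \<Rightarrow> (real^'n::finite) set \<Rightarrow> (real^'n \<Rightarrow> complex) \<Rightarrow> bool" where
  "Ck_boundary k \<Omega> g \<longleftrightarrow> (\<exists>h. Ck_on k UNIV h \<and> (\<forall>x\<in>frontier \<Omega>. h x = g x))"

definition test_function ::
  "(real^'n::finite) set \<Rightarrow> (real^'n \<Rightarrow> complex) \<Rightarrow> bool" where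
  "test_function \<Omega> g \<longleftrightarrow> (\<forall>k. Ck_on k UNIV g) \<and>
     (\<exists>K. compact K \<and> K \<subseteq> \<Omega> \<and> (\<forall>x. x \<notin> K \<longrightarrow> g x = 0))"


section \<open>Domains with regular boundary\<close>

definition gradient :: "(real^'n::finite \<Rightarrow> real) \<Rightarrow> real^'n \<Rightarrow> real^'n" where
  "gradient r x = (\<chi> i. partial_deriv i r x)"

definition local_defining_function ::
  "nat \<Rightarrow> (real^'n::finite) set \<Rightarrow> (real^'n) set \<Rightarrow> (real^'n \<Rightarrow> real) \<Rightarrow> bool" where
  "local_defining_function k \<Omega> U r \<longleftrightarrow> open U \<and> Ck_on k U r \<and>
     (\<forall>y\<in>U. gradient r y \<noteq> 0) \<and> \<Omega> \<inter> U = {y\<in>U. r y < 0}"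

definition Ck_domain_boundary :: "nat \<Rightarrow> (real^'n::finite) set \<Rightarrow> bool" where
  "Ck_domain_boundary k \<Omega> \<longleftrightarrow>
     (\<forall>x\<in>frontier \<Omega>. \<exists>U r. x \<in> U \<and> local_defining_function k \<Omega> U r)"

definition outer_unit_normal :: "(real^'n::finite) set \<Rightarrow> real^'n \<Rightarrow> real^'n \<Rightarrow> bool" where
  "outer_unit_normal \<Omega> x \<nu> \<longleftrightarrow>
     (\<exists>U r. x \<in> U \<and> local_defining_function 1 \<Omega> U r \<and>
            \<nu> = (1 / norm (gradient r x)) *\<^sub>R gradient r x)"


section \<open>Differential operators and boundary conditions\<close>

text \<open>A coefficient family assigns to each multi-index a function; only orders \<open>\<le> k\<close> are used.\<close>

definition diff_op ::
  "(real, 'n::{finite,linorder}) vec set \<Rightarrow> nat \<Rightarrow> (('n \<Rightarrow> nat) \<Rightarrow> (real, 'n) vec \<Rightarrow> complex)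
    \<Rightarrow> ((real, 'n) vec \<Rightarrow> complex) \<Rightarrow> (real, 'n) vec \<Rightarrow> complex" where
  "diff_op \<Omega> k c g x = (\<Sum>\<alpha> | mlen \<alpha> \<le> k. c \<alpha> x * D_closed \<Omega> \<alpha> g x)"

definition principal_symbol ::
  "nat \<Rightarrow> (('n::finite \<Rightarrow> nat) \<Rightarrow> real^'n \<Rightarrow> complex) \<Rightarrow> real^'n \<Rightarrow> real^'n \<Rightarrow> complex" where
  "principal_symbol k c x \<xi> =
     (\<Sum>\<alpha> | mlen \<alpha> = k. c \<alpha> x * complex_of_real (\<Prod>i\<in>UNIV. (\<xi> $ i) ^ \<alpha> i))"

definition elliptic_on ::
  "(real^'n::finite) set \<Rightarrow> nat \<Rightarrow> (('n \<Rightarrow> nat) \<Rightarrow> real^'n \<Rightarrow> complex) \<Rightarrow> bool" where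
  "elliptic_on S k a \<longleftrightarrow>
     (\<forall>x\<in>S. \<forall>\<xi>. \<xi> \<noteq> 0 \<longrightarrow> principal_symbol k a x \<xi> \<in> \<real> \<and> Re (principal_symbol k a x \<xi>) > 0)"

definition L2_inner ::
  "(real^'n::finite) set \<Rightarrow> (real^'n \<Rightarrow> complex) \<Rightarrow> (real^'n \<Rightarrow> complex) \<Rightarrow> complex" where
  "L2_inner \<Omega> g h = (LINT x:\<Omega>|lborel. g x * cnj (h x))"

text \<open>
  \<open>A\<close> coincides with its formal adjoint \<open>v \<mapsto> \<Sum> D\<^sup>\<alpha> (cnj a\<^sub>\<alpha> v)\<close> on test functions (each \<open>D\<^sub>j\<close> is
  formally selfadjoint because of the factor \<open>1/i\<close>), and its quadratic form is positive there.
\<close>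

definition positive_formally_selfadjoint ::
  "(real, 'n::{finite,linorder}) vec set \<Rightarrow> nat \<Rightarrow> (('n \<Rightarrow> nat) \<Rightarrow> (real, 'n) vec \<Rightarrow> complex) \<Rightarrow> bool" where
  "positive_formally_selfadjoint \<Omega> m a \<longleftrightarrow>
     (\<forall>v. test_function \<Omega> v \<longrightarrow>
        (\<forall>x\<in>\<Omega>. diff_op \<Omega> m a v x = (\<Sum>\<alpha> | mlen \<alpha> \<le> m. D_multi \<alpha> (\<lambda>y. cnj (a \<alpha> y) * v y) x)) \<and>
        ((\<exists>x. v x \<noteq> 0) \<longrightarrow> Re (L2_inner \<Omega> (diff_op \<Omega> m a v) v) > 0))"

text \<open>
  The boundary operators are \<open>B\<^sub>j\<close>, \<open>j = 1, \<dots>, l\<close>, of order \<open>mj j\<close> with coefficients \<open>b j\<close>.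
\<close>

definition normal_system ::
  "(real^'n::finite) set \<Rightarrow> nat \<Rightarrow> (nat \<Rightarrow> nat) \<Rightarrow>
    (nat \<Rightarrow> ('n \<Rightarrow> nat) \<Rightarrow> real^'n \<Rightarrow> complex) \<Rightarrow> bool" where
  "normal_system \<Omega> l mj b \<longleftrightarrow> inj_on mj {1..l} \<and>
     (\<forall>j\<in>{1..l}. \<forall>x\<in>frontier \<Omega>. \<forall>\<nu>. outer_unit_normal \<Omega> x \<nu> \<longrightarrow>
        principal_symbol (mj j) (b j) x \<nu> \<noteq> 0)"

text \<open>The principal symbol at \<open>\<xi> + \<tau> \<nu>\<close> as a polynomial in \<open>\<tau>\<close>.\<close>

definition symbol_poly ::
  "nat \<Rightarrow> (('n::finite \<Rightarrow> nat) \<Rightarrow> real^'n \<Rightarrow> complex) \<Rightarrow> real^'n \<Rightarrow> real^'n \<Rightarrow> real^'n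
    \<Rightarrow> complex poly" where
  "symbol_poly k c x \<xi> \<nu> =
     (\<Sum>\<alpha> | mlen \<alpha> = k. Polynomial.smult (c \<alpha> x)
        (\<Prod>i\<in>UNIV. [:complex_of_real (\<xi> $ i), complex_of_real (\<nu> $ i):] ^ \<alpha> i))"

definition upper_factor :: "complex poly \<Rightarrow> complex poly" where
  "upper_factor p = (\<Prod>z | poly p z = 0 \<and> Im z > 0. [:-z, 1:] ^ Polynomial.order z p)"

text \<open>
  The complementing (Lopatinskii-Shapiro) condition: for every nonzero vector \<open>\<xi>\<close> tangent to the
  boundary, the polynomials \<open>\<tau> \<mapsto> B\<^sub>j\<^sup>0(x, \<xi> + \<tau> \<nu>)\<close> are linearly independent modulo the product of
  the \<open>\<tau> - \<tau>\<^sub>k\<close> over the roots \<open>\<tau>\<^sub>k\<close> of \<open>A\<^sup>0(x, \<xi> + \<tau> \<nu>)\<close> in the upper half plane.  By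
  homogeneity, it does not matter whether the inner or the outer normal is taken.
\<close>

definition complementing_condition ::
  "(real^'n::finite) set \<Rightarrow> nat \<Rightarrow> (('n \<Rightarrow> nat) \<Rightarrow> real^'n \<Rightarrow> complex) \<Rightarrow> (nat \<Rightarrow> nat) \<Rightarrow>
    (nat \<Rightarrow> ('n \<Rightarrow> nat) \<Rightarrow> real^'n \<Rightarrow> complex) \<Rightarrow> bool" where
  "complementing_condition \<Omega> l a mj b \<longleftrightarrow>
     (\<forall>x\<in>frontier \<Omega>. \<forall>\<nu> \<xi>. outer_unit_normal \<Omega> x \<nu> \<longrightarrow> \<xi> \<noteq> 0 \<longrightarrow> \<xi> \<bullet> \<nu> = 0 \<longrightarrow>
        (\<forall>c :: nat \<Rightarrow> complex.
           upper_factor (symbol_poly (2 * l) a x \<xi> \<nu>) dvd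
             (\<Sum>j\<in>{1..l}. Polynomial.smult (c j) (symbol_poly (mj j) (b j) x \<xi> \<nu>))
           \<longrightarrow> (\<forall>j\<in>{1..l}. c j = 0)))"

definition operator_domain ::
  "(real, 'n::{finite,linorder}) vec set \<Rightarrow> nat \<Rightarrow> (nat \<Rightarrow> nat) \<Rightarrow>
    (nat \<Rightarrow> ('n \<Rightarrow> nat) \<Rightarrow> (real, 'n) vec \<Rightarrow> complex) \<Rightarrow> ((real, 'n) vec \<Rightarrow> complex) set" where
  "operator_domain \<Omega> l mj b =
     {g. Ck_closure (2 * l) \<Omega> g \<and>
         (\<forall>j\<in>{1..l}. \<forall>x\<in>frontier \<Omega>. diff_op \<Omega> (mj j) (b j) g x = 0)}"

definition symmetric_positive ::
  "(real, 'n::{finite,linorder}) vec set \<Rightarrow> nat \<Rightarrow> (('n \<Rightarrow> nat) \<Rightarrow> (real, 'n) vec \<Rightarrow> complex) \<Rightarrow>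
    (nat \<Rightarrow> nat) \<Rightarrow> (nat \<Rightarrow> ('n \<Rightarrow> nat) \<Rightarrow> (real, 'n) vec \<Rightarrow> complex) \<Rightarrow> bool" where
  "symmetric_positive \<Omega> l a mj b \<longleftrightarrow>
     (\<forall>g\<in>operator_domain \<Omega> l mj b. \<forall>h\<in>operator_domain \<Omega> l mj b.
        L2_inner \<Omega> (diff_op \<Omega> (2 * l) a g) h = L2_inner \<Omega> g (diff_op \<Omega> (2 * l) a h)) \<and>
     (\<forall>g\<in>operator_domain \<Omega> l mj b. (\<exists>x\<in>\<Omega>. g x \<noteq> 0) \<longrightarrow>
        Re (L2_inner \<Omega> (diff_op \<Omega> (2 * l) a g) g) > 0)"

text \<open>
  Agmon's conditions.  ``Sufficiently smooth'' is read as: boundary of class \<open>C\<^sup>m\<close>, \<open>m = 2l\<close>,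
  \<open>a\<^sub>\<alpha>\<close> of class \<open>C\<^bsup>|\<alpha>|\<^esup>\<close> up to the boundary (so that the formal adjoint makes sense), and the
  coefficients of \<open>B\<^sub>j\<close> of class \<open>C\<^bsup>m - mj\<^esup>\<close> on the boundary.
\<close>

definition condition_A ::
  "(real, 'n::{finite,linorder}) vec set \<Rightarrow> nat \<Rightarrow> (('n \<Rightarrow> nat) \<Rightarrow> (real, 'n) vec \<Rightarrow> complex) \<Rightarrow>
    (nat \<Rightarrow> nat) \<Rightarrow> (nat \<Rightarrow> ('n \<Rightarrow> nat) \<Rightarrow> (real, 'n) vec \<Rightarrow> complex) \<Rightarrow> bool" where
  "condition_A \<Omega> l a mj b \<longleftrightarrow>
     Ck_domain_boundary (2 * l) \<Omega> \<and>
     (\<forall>\<alpha>. mlen \<alpha> \<le> 2 * l \<longrightarrow> Ck_closure (mlen \<alpha>) \<Omega> (a \<alpha>)) \<and>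
     (\<forall>j\<in>{1..l}. \<forall>\<alpha>. mlen \<alpha> \<le> mj j \<longrightarrow> Ck_boundary (2 * l - mj j) \<Omega> (b j \<alpha>)) \<and>
     elliptic_on (closure \<Omega>) (2 * l) a \<and>
     normal_system \<Omega> l mj b \<and>
     complementing_condition \<Omega> l a mj b \<and>
     symmetric_positive \<Omega> l a mj b"


section \<open>Riemann-Liouville derivatives\<close>

definition RL_integral :: "real \<Rightarrow> (real \<Rightarrow> complex) \<Rightarrow> real \<Rightarrow> complex" where
  "RL_integral \<rho> h t =
     (1 / Gamma (-\<rho>)) *\<^sub>R (LINT \<xi>:{0..t}|lborel. h \<xi> / complex_of_real ((t - \<xi>) powr (\<rho> + 1)))"

definition frac_deriv_nonpos :: "real \<Rightarrow> (real \<Rightarrow> complex) \<Rightarrow> real \<Rightarrow> complex" where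
  "frac_deriv_nonpos \<rho> h = (if \<rho> < 0 then RL_integral \<rho> h else h)"

definition frac_deriv :: "real \<Rightarrow> (real \<Rightarrow> complex) \<Rightarrow> real \<Rightarrow> complex" where
  "frac_deriv \<rho> h t =
     (if \<rho> \<le> 0 then frac_deriv_nonpos \<rho> h t
      else vector_derivative (frac_deriv_nonpos (\<rho> - 1) h) (at t))"

text \<open>
  The integral defining a derivative of order \<open>\<rho> < 0\<close> is required to exist in the sense of Lebesgue.
\<close>

definition frac_deriv_nonpos_exists :: "real \<Rightarrow> (real \<Rightarrow> complex) \<Rightarrow> bool" where
  "frac_deriv_nonpos_exists \<rho> h \<longleftrightarrow> (\<rho> < 0 \<longrightarrow>
     (\<forall>t>0. set_integrable lborel {0..t} (\<lambda>\<xi>. h \<xi> / complex_of_real ((t - \<xi>) powr (\<rho> + 1)))))"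

definition frac_deriv_exists :: "real \<Rightarrow> (real \<Rightarrow> complex) \<Rightarrow> bool" where
  "frac_deriv_exists \<rho> h \<longleftrightarrow>
     (if \<rho> \<le> 0 then frac_deriv_nonpos_exists \<rho> h
      else frac_deriv_nonpos_exists (\<rho> - 1) h \<and>
           (\<forall>t>0. frac_deriv_nonpos (\<rho> - 1) h differentiable (at t)))"


section \<open>Regular solutions\<close>

text \<open>
  Continuity of \<open>\<partial>\<^sub>t\<^bsup>\<rho>-1\<^esup> u\<close> on the closure times \<open>[0,\<infinity>)\<close> means that the function, given by its defining
  formula for \<open>t > 0\<close>, extends continuously to \<open>t = 0\<close> (the integral over \<open>[0,0]\<close> would always be \<open>0\<close>).
\<close>

definition regular_solution ::
  "real \<Rightarrow> (real, 'n::{finite,linorder}) vec set \<Rightarrow> nat \<Rightarrow> (('n \<Rightarrow> nat) \<Rightarrow> (real, 'n) vec \<Rightarrow> complex) \<Rightarrow>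
    (nat \<Rightarrow> nat) \<Rightarrow> (nat \<Rightarrow> ('n \<Rightarrow> nat) \<Rightarrow> (real, 'n) vec \<Rightarrow> complex) \<Rightarrow>
    ((real, 'n) vec \<Rightarrow> real \<Rightarrow> complex) \<Rightarrow> ((real, 'n) vec \<Rightarrow> complex) \<Rightarrow> ((real, 'n) vec \<Rightarrow> real \<Rightarrow> complex) \<Rightarrow> bool" where
  "regular_solution \<rho> \<Omega> l a mj b f \<phi> u \<longleftrightarrow>
     (\<forall>x\<in>closure \<Omega>. frac_deriv_exists \<rho> (u x)) \<and>
     continuous_on (closure \<Omega> \<times> {0<..}) (\<lambda>(x, t). frac_deriv \<rho> (u x) t) \<and>
     continuous_on (closure \<Omega> \<times> {0<..}) (\<lambda>(x, t). u x t) \<and>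
     (\<forall>t>0. Ck_on (2 * l) \<Omega> (\<lambda>x. u x t)) \<and>
     (\<forall>\<alpha>. mlen \<alpha> \<le> 2 * l \<longrightarrow>
        continuous_on (closure \<Omega> \<times> {0<..}) (\<lambda>(x, t). D_closed \<Omega> \<alpha> (\<lambda>y. u y t) x)) \<and>
     (\<exists>v. continuous_on (closure \<Omega> \<times> {0..}) (\<lambda>(x, t). v x t) \<and>
          (\<forall>x\<in>closure \<Omega>. \<forall>t>0. v x t = frac_deriv (\<rho> - 1) (u x) t)) \<and>
     (\<forall>x\<in>\<Omega>. \<forall>t>0. frac_deriv \<rho> (u x) t + diff_op \<Omega> (2 * l) a (\<lambda>y. u y t) x = f x t) \<and>
     (\<forall>x\<in>\<Omega>. (frac_deriv (\<rho> - 1) (u x) \<longlongrightarrow> \<phi> x) (at_right 0)) \<and>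
     (\<forall>j\<in>{1..l}. \<forall>x\<in>frontier \<Omega>. \<forall>t>0. diff_op \<Omega> (mj j) (b j) (\<lambda>y. u y t) x = 0)"

end

theory Submission
  imports Defs
begin

text \<open>
  The proof is an energy argument that avoids eigenfunction expansions.  Let \<open>w = u - v\<close>, a solution of
  the homogeneous problem, and let \<open>y = \<partial>\<^sub>t\<^bsup>\<rho>-1\<^esup> w\<close>, which is continuous up to \<open>t = 0\<close> with \<open>y(x, 0) = 0\<close>.
  No bound on \<open>w\<close> near \<open>t = 0\<close> that is uniform in \<open>x\<close> is available, so everything is expressed through
  \<open>y\<close>: by Abel's inversion, \<open>W(t) = \<integral>\<^sub>0\<^sup>t w\<close> is the fractional integral of order \<open>\<rho>\<close> of \<open>y\<close>.  For
  \<open>0 < \<epsilon> < t\<close> the function \<open>W(t) - W(\<epsilon>) = \<integral>\<^sub>\<epsilon>\<^sup>t w\<close> lies in the domain of \<open>A\<close>, and \<open>A\<close> maps it to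
  \<open>-(y(t) - y(\<epsilon>))\<close>; positivity of \<open>A\<close> and \<open>\<epsilon> \<rightarrow> 0\<close> give \<open>Re (y(t), W(t)) \<le> 0\<close> in \<open>L\<^sub>2(\<Omega>)\<close> for all \<open>t\<close>.
  On the other hand, the kernel of the fractional integral is strictly positive definite: for each
  \<open>x\<close> the integral of \<open>(T - t) Re (y \<cdot> cnj W)\<close> over \<open>[0, T]\<close> is nonnegative and vanishes only if \<open>y = 0\<close>,
  because \<open>r\<^bsup>\<rho>-1\<^esup>\<close> is a positive superposition of exponentials \<open>e\<^bsup>-\<sigma>r\<^esup>\<close>.  Hence \<open>y = 0\<close>, \<open>W = 0\<close> and \<open>w = 0\<close>.
\<close>

section \<open>Partial derivatives\<close>

lemma eventually_line_in_open:
  fixes x e :: "'a::real_normed_vector"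
  assumes "open S" "x \<in> S"
  shows "\<forall>\<^sub>F s in nhds (0::real). x + s *\<^sub>R e \<in> S"
proof -
  have "open ((\<lambda>s::real. x + s *\<^sub>R e) -` S)"
    by (intro open_vimage assms continuous_intros)
  from eventually_nhds_in_open[OF this, of 0] show ?thesis using assms by simp
qed

lemma partial_deriv_cong:
  assumes "open S" "x \<in> S" "\<And>y. y \<in> S \<Longrightarrow> g y = h y"
  shows "partial_deriv i g x = partial_deriv i h x"
proof -
  have "\<forall>\<^sub>F s in nhds (0::real). s \<in> UNIV \<longrightarrow> g (x + s *\<^sub>R axis i 1) = h (x + s *\<^sub>R axis i 1)"
    using eventually_line_in_open[OF assms(1,2)] by eventually_elim (use assms(3) in auto)
  then show ?thesis unfolding partial_deriv_def by (rule vector_derivative_cong_eq) auto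
qed

lemma differentiable_line_cong:
  fixes g h :: "real^'n::finite \<Rightarrow> 'b::real_normed_vector"
  assumes "open S" "x \<in> S" "\<And>y. y \<in> S \<Longrightarrow> g y = h y"
    and "(\<lambda>s. g (x + s *\<^sub>R axis i 1)) differentiable (at 0)"
  shows "(\<lambda>s. h (x + s *\<^sub>R axis i 1)) differentiable (at 0)"
proof -
  have ev: "\<forall>\<^sub>F s in nhds (0::real). g (x + s *\<^sub>R axis i 1) = h (x + s *\<^sub>R axis i 1)"
    using eventually_line_in_open[OF assms(1,2)] by eventually_elim (use assms(3) in auto)
  obtain D where D: "((\<lambda>s. g (x + s *\<^sub>R axis i 1)) has_vector_derivative D) (at 0)"
    using assms(4) vector_derivative_works by blast
  have "((\<lambda>s. h (x + s *\<^sub>R axis i 1)) has_vector_derivative D) (at 0)"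
    by (rule iffD1[OF has_vector_derivative_cong_ev D])
       (use ev assms in \<open>auto elim: eventually_mono\<close>)
  then show ?thesis by (rule differentiableI_vector)
qed

text \<open>\<open>Ck_on\<close> tests a function along short lines through the points of S, and
  these could leave S; openness makes the values outside S irrelevant, at every level of the
  recursion.\<close>

lemma Ck_on_cong:
  assumes "open S" "\<And>y. y \<in> S \<Longrightarrow> g y = h y" "Ck_on k S g"
  shows "Ck_on k S h"
  using assms(2,3)
proof (induction k arbitrary: g h)
  case 0
  then show ?case using continuous_on_cong[of S S g h] by simp
next
  case (Suc k)
  have "continuous_on S h" using Suc.prems continuous_on_cong[of S S g h] by simp
  moreover have "(\<lambda>s. h (x + s *\<^sub>R axis i 1)) differentiable (at 0)" if "x \<in> S" for x i
  proof (rule differentiable_line_cong[where g = g])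
    show "(\<lambda>s. g (x + s *\<^sub>R axis i 1)) differentiable (at 0)" using Suc.prems(2) that by auto
  qed (use assms(1) that Suc.prems(1) in blast)+
  moreover have "Ck_on k S (partial_deriv i h)" for i
  proof (rule Suc.IH)
    show "Ck_on k S (partial_deriv i g)" using Suc.prems(2) by auto
  qed (rule partial_deriv_cong[OF assms(1) _ Suc.prems(1)])
  ultimately show ?case by auto
qed

lemma Ck_on_Suc_D: "Ck_on (Suc k) S g \<Longrightarrow> Ck_on k S g"
  by (induction k arbitrary: g) auto

lemma Ck_on_mono: "Ck_on k S g \<Longrightarrow> j \<le> k \<Longrightarrow> Ck_on j S g"
  by (induction k) (auto simp del: Ck_on.simps dest: Ck_on_Suc_D elim: le_SucE)

text \<open>\<open>Ck_on\<close> only speaks of the derivative at parameter 0. Taking x + s e as the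
  new base point, e the coordinate direction, moves it to parameter s.\<close>

lemma has_vector_derivative_line:
  assumes "Ck_on (Suc k) S g" "x + s *\<^sub>R axis i 1 \<in> S"
  shows "((\<lambda>s. g (x + s *\<^sub>R axis i 1)) has_vector_derivative partial_deriv i g (x + s *\<^sub>R axis i 1)) (at s)"
proof -
  have "(\<lambda>r. g ((x + s *\<^sub>R axis i 1) + r *\<^sub>R axis i 1)) differentiable (at 0)"
    using assms by simp
  then have "((\<lambda>r. g ((x + s *\<^sub>R axis i 1) + r *\<^sub>R axis i 1)) has_vector_derivative
      partial_deriv i g (x + s *\<^sub>R axis i 1)) (at (0 + 0))"
    by (simp add: vector_derivative_works partial_deriv_def)
  then have "((\<lambda>r. g ((x + s *\<^sub>R axis i 1) + (r - s) *\<^sub>R axis i 1)) has_vector_derivative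
      partial_deriv i g (x + s *\<^sub>R axis i 1)) (at s)"
    using vector_diff_chain_at[of "\<lambda>r. r - s" 1 s "\<lambda>r. g ((x + s *\<^sub>R axis i 1) + r *\<^sub>R axis i 1)"
      "partial_deriv i g (x + s *\<^sub>R axis i 1)"]
    by (simp add: o_def has_vector_derivative_diff_const)
  then show ?thesis by (simp add: algebra_simps)
qed

lemma partial_deriv_eqI:
  "((\<lambda>s. g (x + s *\<^sub>R axis i 1)) has_vector_derivative d) (at 0) \<Longrightarrow> partial_deriv i g x = d"
  unfolding partial_deriv_def by (rule vector_derivative_at)

text \<open>Leibniz rule along a coordinate line, restricted to parameters for which the line stays
  in a ball inside S. It is used twice: with \<tau> running along another coordinate axis for the
  symmetry of second derivatives, and with \<tau> as time for time integrals of solutions.\<close>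

lemma has_vector_derivative_line_integral:
  fixes G :: "real^'n::finite \<Rightarrow> real \<Rightarrow> complex"
  assumes S: "open S" "x \<in> S"
    and C1: "\<And>\<tau>. \<tau> \<in> {p..q} \<Longrightarrow> Ck_on 1 S (\<lambda>y. G y \<tau>)"
    and int: "\<And>y. y \<in> S \<Longrightarrow> G y integrable_on {p..q}"
    and cont: "continuous_on (S \<times> {p..q}) (\<lambda>(y, \<tau>). partial_deriv i (\<lambda>y. G y \<tau>) y)"
  shows "((\<lambda>s. integral {p..q} (G (x + s *\<^sub>R axis i 1))) has_vector_derivative
      integral {p..q} (\<lambda>\<tau>. partial_deriv i (\<lambda>y. G y \<tau>) x)) (at 0)"
proof -
  obtain d where d: "d > 0" "ball x d \<subseteq> S" using S openE by blast
  have inS: "x + s *\<^sub>R axis i 1 \<in> S" if "s \<in> ball 0 d" for s :: real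
  proof -
    have "dist x (x + s *\<^sub>R axis i 1) < d" using that by (simp add: dist_norm norm_axis_1)
    then show ?thesis using d(2) by auto
  qed
  have "((\<lambda>s. integral (cbox p q) (G (x + s *\<^sub>R axis i 1))) has_vector_derivative
      integral (cbox p q) ((\<lambda>s \<tau>. partial_deriv i (\<lambda>y. G y \<tau>) (x + s *\<^sub>R axis i 1)) 0)) (at 0 within ball 0 d)"
  proof (rule leibniz_rule_vector_derivative)
    fix s t :: real assume s: "s \<in> ball 0 d" and t: "t \<in> cbox p q"
    show "((\<lambda>s. G (x + s *\<^sub>R axis i 1) t) has_vector_derivative
        partial_deriv i (\<lambda>y. G y t) (x + s *\<^sub>R axis i 1)) (at s within ball 0 d)"
    proof (rule has_vector_derivative_at_within, rule has_vector_derivative_line)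
      show "Ck_on (Suc 0) S (\<lambda>y. G y t)" using C1[of t] t by (simp only: One_nat_def cbox_interval)
    qed (rule inS[OF s])
  next
    fix s :: real assume "s \<in> ball 0 d"
    then show "G (x + s *\<^sub>R axis i 1) integrable_on cbox p q"
      unfolding cbox_interval by (intro int inS)
  next
    have "continuous_on (ball 0 d \<times> cbox p q) (\<lambda>z. (x + fst z *\<^sub>R axis i 1, snd z))"
      by (intro continuous_intros)
    then show "continuous_on (ball 0 d \<times> cbox p q)
       (\<lambda>(s, \<tau>). partial_deriv i (\<lambda>y. G y \<tau>) (x + s *\<^sub>R axis i 1))"
      unfolding split_beta
      using continuous_on_compose2[OF cont[unfolded split_beta], of "ball 0 d \<times> cbox p q"
          "\<lambda>z. (x + fst z *\<^sub>R axis i 1, snd z)"] inS by (simp add: image_subset_iff)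
  qed (use d in auto)
  moreover have "at 0 within ball 0 d = at (0::real)"
    using d by (intro at_within_open) auto
  ultimately show ?thesis by simp
qed

lemma partial_deriv_shift: "partial_deriv i (\<lambda>y. g (y + c)) x = partial_deriv i g (x + c)"
  unfolding partial_deriv_def by (simp add: algebra_simps)

text \<open>Write g(y + t e) as g(y) plus the integral over [0,t] of the j-th derivative along e,
  the j-th axis. Differentiating in direction i under the integral expresses the i-th derivative at
  x + t e as an integral with upper limit t; its t-derivative at 0 is one mixed derivative by the
  fundamental theorem and the other by definition.\<close>

lemma partial_deriv_commute:
  fixes g :: "real^'n::finite \<Rightarrow> complex"
  assumes S: "open S" "x \<in> S" and C2: "Ck_on (Suc (Suc 0)) S g"
  shows "partial_deriv i (partial_deriv j g) x = partial_deriv j (partial_deriv i g) x"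
proof -
  let ?e = "axis j (1::real)"
  obtain d where d: "d > 0" "ball x d \<subseteq> S" using S openE by blast
  \<comment> \<open>Half the radius for the base point y and half for the shift t e, so that y + t e
    stays in the ball of radius d.\<close>
  define r where "r = d / 2"
  have r: "r > 0" using d by (simp add: r_def)
  have inS: "y + t *\<^sub>R ?e \<in> S" if "y \<in> ball x r" "t \<in> {0..r}" for y t
  proof -
    have "dist x (y + t *\<^sub>R ?e) \<le> dist x y + norm (t *\<^sub>R ?e)"
      using norm_triangle_ineq4[of "x - y" "t *\<^sub>R ?e"] by (simp add: dist_norm diff_diff_eq)
    also have "norm (t *\<^sub>R ?e) = t" using that by (simp add: norm_axis_1)
    also have "dist x y + t < r + r" using that by (intro add_less_le_mono) auto
    finally show ?thesis using d by (auto simp: r_def subset_iff)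
  qed
  have C1: "Ck_on 1 S g" "Ck_on 1 S (partial_deriv i g)" "Ck_on 1 S (partial_deriv j g)"
    using C2 by auto
  have cij: "continuous_on S (partial_deriv i (partial_deriv j g))" using C2 by auto
  have contj: "continuous_on S (partial_deriv j g)" using C2 by auto
  have eq: "partial_deriv i g (x + t *\<^sub>R ?e) = partial_deriv i g x +
      integral {0..t} (\<lambda>\<tau>. partial_deriv i (partial_deriv j g) (x + \<tau> *\<^sub>R ?e))"
    if t: "t \<in> {0..r}" for t
  proof -
    have FTC: "g (y + t *\<^sub>R ?e) = g y + integral {0..t} (\<lambda>\<tau>. partial_deriv j g (y + \<tau> *\<^sub>R ?e))"
      if "y \<in> ball x r" for y
    proof -
      have "((\<lambda>\<tau>. partial_deriv j g (y + \<tau> *\<^sub>R ?e)) has_integral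
          (g (y + t *\<^sub>R ?e) - g (y + 0 *\<^sub>R ?e))) {0..t}"
      proof (rule fundamental_theorem_of_calculus)
        fix \<tau> assume "\<tau> \<in> {0..t}"
        then show "((\<lambda>\<tau>. g (y + \<tau> *\<^sub>R ?e)) has_vector_derivative partial_deriv j g (y + \<tau> *\<^sub>R ?e))
            (at \<tau> within {0..t})"
          using t that inS C1 by (intro has_vector_derivative_line[of 0 S g, THEN has_vector_derivative_at_within]) auto
      qed (use t in auto)
      then show ?thesis by (simp add: integral_unique)
    qed
    have "((\<lambda>s. integral {0..t} ((\<lambda>y \<tau>. partial_deriv j g (y + \<tau> *\<^sub>R ?e)) (x + s *\<^sub>R axis i 1))) has_vector_derivative
      integral {0..t} (\<lambda>\<tau>. partial_deriv i (\<lambda>y. partial_deriv j g (y + \<tau> *\<^sub>R ?e)) x)) (at 0)"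
    proof (rule has_vector_derivative_line_integral[where S="ball x r"])
      fix \<tau> assume \<tau>: "\<tau> \<in> {0..t}"
      have c: "continuous_on (ball x r) (\<lambda>y. h (y + \<tau> *\<^sub>R ?e))" if "continuous_on S h" for h :: "real^'n \<Rightarrow> complex"
        by (rule continuous_on_compose2[OF that]) (use inS \<tau> t in \<open>auto intro!: continuous_intros\<close>)
      have "(\<lambda>s. partial_deriv j g (y + s *\<^sub>R axis k 1 + \<tau> *\<^sub>R ?e)) differentiable at 0"
        if "y \<in> ball x r" for k y
      proof -
        have "(\<lambda>s. partial_deriv j g ((y + \<tau> *\<^sub>R ?e) + s *\<^sub>R axis k 1)) differentiable at 0"
          using C1(3) inS[OF that, of \<tau>] \<tau> t by auto
        moreover have "(y + \<tau> *\<^sub>R ?e) + s *\<^sub>R axis k 1 = y + s *\<^sub>R axis k 1 + \<tau> *\<^sub>R ?e" for s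
          by simp
        ultimately show ?thesis by simp
      qed
      moreover have "partial_deriv k (\<lambda>y. partial_deriv j g (y + \<tau> *\<^sub>R ?e)) =
          (\<lambda>y. partial_deriv k (partial_deriv j g) (y + \<tau> *\<^sub>R ?e))" for k
        by (rule ext) (rule partial_deriv_shift)
      moreover have "continuous_on S (partial_deriv k (partial_deriv j g))" for k
        using C2 by auto
      ultimately show "Ck_on 1 (ball x r) (\<lambda>y. partial_deriv j g (y + \<tau> *\<^sub>R ?e))"
        using c[OF contj] c[of "partial_deriv k (partial_deriv j g)" for k]
        by simp
    next
      fix y assume y: "y \<in> ball x r"
      show "(\<lambda>\<tau>. partial_deriv j g (y + \<tau> *\<^sub>R ?e)) integrable_on {0..t}"
        by (intro integrable_continuous_real continuous_on_compose2[OF contj])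
           (use inS y t in \<open>auto intro!: continuous_intros\<close>)
    next
      show "continuous_on (ball x r \<times> {0..t})
        (\<lambda>(y, \<tau>). partial_deriv i (\<lambda>y. partial_deriv j g (y + \<tau> *\<^sub>R ?e)) y)"
        unfolding partial_deriv_shift[of i "partial_deriv j g"] split_beta
        by (intro continuous_on_compose2[OF cij])
           (use inS t in \<open>auto intro!: continuous_intros\<close>)
    qed (use r in auto)
    moreover have "((\<lambda>s. g (x + s *\<^sub>R axis i 1)) has_vector_derivative partial_deriv i g x) (at 0)"
      using has_vector_derivative_line[of 0 S g x 0 i] C1 S by simp
    ultimately have "((\<lambda>s. g (x + s *\<^sub>R axis i 1) + integral {0..t} (\<lambda>\<tau>. partial_deriv j g (x + s *\<^sub>R axis i 1 + \<tau> *\<^sub>R ?e))) has_vector_derivative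
       partial_deriv i g x + integral {0..t} (\<lambda>\<tau>. partial_deriv i (partial_deriv j g) (x + \<tau> *\<^sub>R ?e))) (at 0)"
      unfolding partial_deriv_shift[of i "partial_deriv j g"] by (intro has_vector_derivative_add)
    then have "partial_deriv i (\<lambda>y. g y + integral {0..t} (\<lambda>\<tau>. partial_deriv j g (y + \<tau> *\<^sub>R ?e))) x
       = partial_deriv i g x + integral {0..t} (\<lambda>\<tau>. partial_deriv i (partial_deriv j g) (x + \<tau> *\<^sub>R ?e))"
      by (rule partial_deriv_eqI)
    moreover have "partial_deriv i (\<lambda>y. g (y + t *\<^sub>R ?e)) x =
       partial_deriv i (\<lambda>y. g y + integral {0..t} (\<lambda>\<tau>. partial_deriv j g (y + \<tau> *\<^sub>R ?e))) x"
      by (rule partial_deriv_cong[of "ball x r"]) (use FTC r in auto)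
    ultimately show ?thesis unfolding partial_deriv_shift[of i g "t *\<^sub>R ?e"] by simp
  qed
  \<comment> \<open>The formula \<open>eq\<close> covers only t \<ge> 0, so the t-derivative at 0 is
    taken one-sidedly; it is still unique, 0 being an endpoint of a nondegenerate interval.\<close>
  have "((\<lambda>t. integral {0..t} (\<lambda>\<tau>. partial_deriv i (partial_deriv j g) (x + \<tau> *\<^sub>R ?e)))
      has_vector_derivative partial_deriv i (partial_deriv j g) (x + 0 *\<^sub>R ?e)) (at 0 within {0..r})"
    by (rule integral_has_vector_derivative, rule continuous_on_compose2[OF cij])
       (use inS r in \<open>auto intro!: continuous_intros\<close>)
  then have "((\<lambda>t. partial_deriv i g x + integral {0..t} (\<lambda>\<tau>. partial_deriv i (partial_deriv j g) (x + \<tau> *\<^sub>R ?e)))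
      has_vector_derivative partial_deriv i (partial_deriv j g) x) (at 0 within {0..r})"
    by (auto intro!: derivative_eq_intros)
  then have "((\<lambda>t. partial_deriv i g (x + t *\<^sub>R ?e))
      has_vector_derivative partial_deriv i (partial_deriv j g) x) (at 0 within {0..r})"
    by (rule has_vector_derivative_transform[rotated 2]) (use r eq in auto)
  moreover have "((\<lambda>t. partial_deriv i g (x + t *\<^sub>R ?e))
      has_vector_derivative partial_deriv j (partial_deriv i g) x) (at 0 within {0..r})"
    using has_vector_derivative_line[of 0 S "partial_deriv i g" x 0 j, THEN has_vector_derivative_at_within] C1 S
    by simp
  ultimately show ?thesis
    using vector_derivative_unique_within_closed_interval[of 0 r 0 "\<lambda>t. partial_deriv i g (x + t *\<^sub>R ?e)"] r
    by auto
qed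

section \<open>Linearity of the derivatives and commutation of the operators
  \<open>D_op\<close>\<close>

lemma partial_deriv_lincomb:
  fixes g h :: "real^'n::finite \<Rightarrow> complex"
  assumes "Ck_on (Suc k) S g" "Ck_on (Suc k) S h" "x \<in> S"
  shows "((\<lambda>s. c * g (x + s *\<^sub>R axis i 1) + d * h (x + s *\<^sub>R axis i 1)) has_vector_derivative
           c * partial_deriv i g x + d * partial_deriv i h x) (at 0)"
    and "partial_deriv i (\<lambda>y. c * g y + d * h y) x = c * partial_deriv i g x + d * partial_deriv i h x"
proof -
  show *: "((\<lambda>s. c * g (x + s *\<^sub>R axis i 1) + d * h (x + s *\<^sub>R axis i 1)) has_vector_derivative
           c * partial_deriv i g x + d * partial_deriv i h x) (at 0)"
    using has_vector_derivative_line[OF assms(1), of x 0 i] has_vector_derivative_line[OF assms(2), of x 0 i] assms(3)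
    by (intro has_vector_derivative_add has_vector_derivative_mult_right) auto
  show "partial_deriv i (\<lambda>y. c * g y + d * h y) x = c * partial_deriv i g x + d * partial_deriv i h x"
    by (rule partial_deriv_eqI[OF *])
qed

lemma Ck_on_lincomb:
  fixes g h :: "real^'n::finite \<Rightarrow> complex"
  assumes "open S" "Ck_on k S g" "Ck_on k S h"
  shows "Ck_on k S (\<lambda>y. c * g y + d * h y)"
  using assms(2,3)
proof (induction k arbitrary: g h)
  case 0
  then show ?case by (auto intro!: continuous_intros)
next
  case (Suc k)
  have "continuous_on S (\<lambda>y. c * g y + d * h y)"
    using Suc.prems by (auto intro!: continuous_intros)
  moreover have "(\<lambda>s. c * g (x + s *\<^sub>R axis i 1) + d * h (x + s *\<^sub>R axis i 1)) differentiable at 0"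
    if "x \<in> S" for x i
    using partial_deriv_lincomb(1)[OF Suc.prems that] by (rule differentiableI_vector)
  moreover have "Ck_on k S (partial_deriv i (\<lambda>y. c * g y + d * h y))" for i
  proof (rule Ck_on_cong[OF assms(1)])
    show "Ck_on k S (\<lambda>x. c * partial_deriv i g x + d * partial_deriv i h x)"
      using Suc.prems by (intro Suc.IH) auto
  qed (simp add: partial_deriv_lincomb(2)[OF Suc.prems])
  ultimately show ?case by simp
qed

lemma Ck_on_cmult:
  fixes g :: "real^'n::finite \<Rightarrow> complex"
  assumes "open S" "Ck_on k S g"
  shows "Ck_on k S (\<lambda>y. c * g y)"
  using Ck_on_lincomb[OF assms assms(2), of c 0] by simp

lemma partial_deriv_cmult:
  fixes g :: "real^'n::finite \<Rightarrow> complex"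
  assumes "Ck_on (Suc k) S g" "x \<in> S"
  shows "partial_deriv i (\<lambda>y. c * g y) x = c * partial_deriv i g x"
  using partial_deriv_lincomb(2)[OF assms(1) assms, of i c 0] by simp

lemma D_op_lincomb:
  assumes "Ck_on (Suc k) S g" "Ck_on (Suc k) S h" "x \<in> S"
  shows "D_op i (\<lambda>y. c * g y + d * h y) x = c * D_op i g x + d * D_op i h x"
  unfolding D_op_def partial_deriv_lincomb(2)[OF assms] by (simp add: algebra_simps)

lemma D_op_cong:
  assumes "open S" "x \<in> S" "\<And>y. y \<in> S \<Longrightarrow> g y = h y"
  shows "D_op i g x = D_op i h x"
  unfolding D_op_def using partial_deriv_cong[OF assms] by simp

lemma Ck_on_D_op:
  assumes "open S" "Ck_on (Suc k) S g"
  shows "Ck_on k S (D_op i g)"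
  unfolding D_op_def[abs_def] using assms by (intro Ck_on_cmult) auto

lemma D_op_commute:
  assumes "open S" "Ck_on (Suc (Suc 0)) S g" "x \<in> S"
  shows "D_op i (D_op j g) x = D_op j (D_op i g) x"
proof -
  have "Ck_on (Suc 0) S (partial_deriv k g)" for k using assms by auto
  note cm = partial_deriv_cmult[OF this assms(3)]
  have "D_op i (D_op j g) x = 1 / \<i> * (1 / \<i> * partial_deriv i (partial_deriv j g) x)" for i j
    unfolding D_op_def[abs_def] cm ..
  then show ?thesis using partial_deriv_commute[OF assms(1,3,2), of i j] by simp
qed

text \<open>
  \<open>Ck_on\<close> involves derivatives in every order, whereas \<open>D_multi\<close> only provides sorted ones; words
  of indices make both accessible, and symmetry of second derivatives lets one sort a word.
\<close>

definition D_word :: "'n::finite list \<Rightarrow> (real^'n \<Rightarrow> complex) \<Rightarrow> real^'n \<Rightarrow> complex" where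
  "D_word ws g = foldr D_op ws g"

lemma D_word_simps [simp]:
  "D_word [] g = g" "D_word (i # ws) g = D_op i (D_word ws g)"
  "D_word (ws @ vs) g = D_word ws (D_word vs g)"
  by (simp_all add: D_word_def)

lemma Ck_on_D_word:
  assumes "open S" "Ck_on (length ws + k) S g"
  shows "Ck_on k S (D_word ws g)"
  using assms(2)
proof (induction ws arbitrary: k)
  case (Cons i ws)
  have "Ck_on (Suc k) S (D_word ws g)" using Cons by (intro Cons.IH) (simp del: Ck_on.simps(2))
  then show ?case using Ck_on_D_op[OF assms(1)] by simp
qed simp

lemma D_word_lincomb:
  assumes "open S" "Ck_on (length ws) S g" "Ck_on (length ws) S h" "x \<in> S"
  shows "D_word ws (\<lambda>y. c * g y + d * h y) x = c * D_word ws g x + d * D_word ws h x"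
  using assms(2-)
proof (induction ws arbitrary: x)
  case (Cons i ws)
  have "Ck_on (length ws) S g" "Ck_on (length ws) S h" using Cons.prems Ck_on_Suc_D by auto
  note IH = Cons.IH[OF this]
  have "D_word (i # ws) (\<lambda>y. c * g y + d * h y) x = D_op i (\<lambda>y. c * D_word ws g y + d * D_word ws h y) x"
    using D_op_cong[OF assms(1) \<open>x \<in> S\<close> IH] by simp
  also have "\<dots> = c * D_op i (D_word ws g) x + d * D_op i (D_word ws h) x"
    using Cons.prems by (intro D_op_lincomb[where k = 0 and S = S] Ck_on_D_word assms(1)) auto
  finally show ?case by simp
qed simp

text \<open>The last letter bubbles to the front, one exchange of two neighbouring derivatives at a
  time.\<close>

lemma D_word_move_front:
  assumes "open S" "Ck_on (length ws + 1) S g" "x \<in> S"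
  shows "D_word (ws @ [i]) g x = D_word (i # ws) g x"
  using assms(2-)
proof (induction ws arbitrary: x)
  case (Cons j ws)
  have "Ck_on (length ws + 1) S g" by (rule Ck_on_mono[OF Cons.prems(1)]) simp
  note IH = Cons.IH[OF this]
  have "D_word ((j # ws) @ [i]) g x = D_op j (D_op i (D_word ws g)) x"
    using D_op_cong[OF assms(1) \<open>x \<in> S\<close> IH] by simp
  also have "\<dots> = D_op i (D_op j (D_word ws g)) x"
    using Cons.prems by (intro D_op_commute[OF assms(1)] Ck_on_D_word assms(1)) simp_all
  finally show ?case by simp
qed simp

text \<open>Induction on ws. Its first letter i occurs somewhere in vs; what remains of vs after
  deleting that occurrence is a permutation of the rest of ws, and i can be moved back to its place
  past the letters in front of it.\<close>

lemma D_word_perm: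
  assumes "open S" "Ck_on (length ws) S g" "x \<in> S" "mset ws = mset vs"
  shows "D_word ws g x = D_word vs g x"
  using assms(2-)
proof (induction ws arbitrary: vs x)
  case (Cons i ws)
  have "i \<in> set vs" using Cons.prems(3) by (metis list.set_intros(1) mset_eq_setD)
  then obtain us us' where vs: "vs = us @ i # us'" by (meson split_list)
  have ms: "mset ws = mset (us @ us')" using Cons.prems(3) vs by simp
  then have len: "length ws = length us + length us'" by (metis length_append size_mset)
  have "D_word (i # ws) g x = D_op i (D_word (us @ us') g) x"
  proof -
    have "Ck_on (length ws) S g" using Cons.prems Ck_on_Suc_D by auto
    from D_op_cong[OF assms(1) Cons.prems(2) Cons.IH[OF this _ ms]] show ?thesis by simp
  qed
  also have "\<dots> = D_word (i # us) (D_word us' g) x" by simp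
  also have "\<dots> = D_word (us @ [i]) (D_word us' g) x"
    using Cons.prems len
    by (intro D_word_move_front[OF assms(1), symmetric] Ck_on_D_word assms(1)) (auto simp: ac_simps)
  finally show ?case using vs by simp
qed simp

definition multi_word :: "('n::{finite,linorder} \<Rightarrow> nat) \<Rightarrow> 'n list" where
  "multi_word \<alpha> = concat (map (\<lambda>i. replicate (\<alpha> i) i) (sorted_list_of_set UNIV))"

lemma D_multi_eq_D_word: "D_multi \<alpha> g = D_word (multi_word \<alpha>) g"
proof -
  have r: "foldr D_op (replicate n i) h = (D_op i ^^ n) h" for n i and h :: "(real, 'a) vec \<Rightarrow> complex"
    by (induction n) auto
  have "foldr (\<lambda>i. D_op i ^^ \<alpha> i) L g = foldr D_op (concat (map (\<lambda>i. replicate (\<alpha> i) i) L)) g" for L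
    by (induction L) (auto simp: r)
  then show ?thesis by (simp add: D_multi_def D_word_def multi_word_def)
qed

lemma count_multi_word: "count (mset (multi_word \<alpha>)) i = \<alpha> i"
proof -
  have "count (mset (concat (map (\<lambda>i. replicate (\<alpha> i) i) L))) i = (if i \<in> set L then \<alpha> i else 0)"
    if "distinct L" for L
    using that by (induction L) auto
  then show ?thesis unfolding multi_word_def by simp
qed

lemma length_multi_word: "length (multi_word \<alpha>) = mlen \<alpha>"
proof -
  have "length (multi_word \<alpha>) = (\<Sum>i\<leftarrow>sorted_list_of_set UNIV. \<alpha> i)"
    by (simp add: multi_word_def length_concat o_def)
  also have "\<dots> = mlen \<alpha>" unfolding mlen_def
    by (subst sum_list_distinct_conv_sum_set) auto
  finally show ?thesis .
qed

lemma mset_multi_word_count: "mset (multi_word (count (mset ws))) = mset ws"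
  by (rule multiset_eqI) (simp add: count_multi_word)

lemma mlen_count_mset:
  fixes ws :: "'n::{finite,linorder} list"
  shows "mlen (count (mset ws)) = length ws"
proof -
  have "mlen (count (mset ws)) = size (mset (multi_word (count (mset ws))))"
    by (simp add: length_multi_word)
  then show ?thesis by (simp only: mset_multi_word_count size_mset)
qed

text \<open>A regular solution comes with joint continuity in (x, t) of sorted derivatives only.
  This equality transfers it to derivatives in arbitrary order, as required for showing that time
  integrals satisfy \<open>Ck_on\<close>.\<close>

lemma D_word_eq_D_multi:
  assumes "open S" "Ck_on k S g" "x \<in> S" "length ws \<le> k"
  shows "D_word ws g x = D_multi (count (mset ws)) g x"
  unfolding D_multi_eq_D_word
  by (rule D_word_perm[OF assms(1) Ck_on_mono[OF assms(2,4)] assms(3) mset_multi_word_count[symmetric]])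

lemma D_multi_lincomb:
  assumes "open S" "Ck_on k S g" "Ck_on k S h" "x \<in> S" "mlen \<alpha> \<le> k"
  shows "D_multi \<alpha> (\<lambda>y. c * g y + d * h y) x = c * D_multi \<alpha> g x + d * D_multi \<alpha> h x"
  unfolding D_multi_eq_D_word
  by (rule D_word_lincomb) (use assms Ck_on_mono in \<open>auto simp: length_multi_word\<close>)

section \<open>Differentiation under the integral sign\<close>

lemma D_op_integral:
  fixes G :: "real^'n::finite \<Rightarrow> real \<Rightarrow> complex"
  assumes S: "open S" "x \<in> S"
    and C1: "\<And>\<tau>. \<tau> \<in> {p..q} \<Longrightarrow> Ck_on 1 S (\<lambda>y. G y \<tau>)"
    and cont: "continuous_on (S \<times> {p..q}) (\<lambda>(y, \<tau>). G y \<tau>)"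
    and cont': "continuous_on (S \<times> {p..q}) (\<lambda>(y, \<tau>). D_op i (\<lambda>y. G y \<tau>) y)"
  shows "(\<lambda>s. integral {p..q} (G (x + s *\<^sub>R axis i 1))) differentiable (at 0)"
    and "D_op i (\<lambda>y. integral {p..q} (G y)) x = integral {p..q} (\<lambda>\<tau>. D_op i (\<lambda>y. G y \<tau>) x)"
proof -
  \<comment> \<open>Multiplication by i undoes the factor 1/i in \<open>D_op\<close>.\<close>
  have "continuous_on (S \<times> {p..q}) (\<lambda>z. \<i> * (case z of (y, \<tau>) \<Rightarrow> D_op i (\<lambda>y. G y \<tau>) y))"
    by (intro continuous_intros cont')
  then have c: "continuous_on (S \<times> {p..q}) (\<lambda>(y, \<tau>). partial_deriv i (\<lambda>y. G y \<tau>) y)"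
    by (simp add: D_op_def split_beta)
  have "G y integrable_on {p..q}" if "y \<in> S" for y
    by (rule integrable_continuous_real, rule continuous_on_compose2[OF cont, of _ "\<lambda>\<tau>. (y, \<tau>)", simplified])
       (use that in \<open>auto intro!: continuous_intros\<close>)
  note * = has_vector_derivative_line_integral[OF S C1 this c]
  show "(\<lambda>s. integral {p..q} (G (x + s *\<^sub>R axis i 1))) differentiable (at 0)"
    using * by (rule differentiableI_vector)
  show "D_op i (\<lambda>y. integral {p..q} (G y)) x = integral {p..q} (\<lambda>\<tau>. D_op i (\<lambda>y. G y \<tau>) x)"
    unfolding D_op_def using partial_deriv_eqI[OF *] by (simp only: integral_mult_right)
qed

lemma Ck_on_SucI:
  fixes g :: "real^'n::finite \<Rightarrow> complex"
  assumes "open S" "continuous_on S g"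
    and "\<And>x i. x \<in> S \<Longrightarrow> (\<lambda>s. g (x + s *\<^sub>R axis i 1)) differentiable (at 0)"
    and "\<And>i. Ck_on k S (D_op i g)"
  shows "Ck_on (Suc k) S g"
proof -
  have "Ck_on k S (\<lambda>x. \<i> * D_op i g x)" for i by (rule Ck_on_cmult[OF assms(1,4)])
  then have "Ck_on k S (partial_deriv i g)" for i by (simp add: D_op_def)
  then show ?thesis using assms by simp
qed

text \<open>The hypothesis is about all words up to length k, not multi-indices, because the
  induction replaces G by \<open>D_op i\<close> of G: this appends i on the right of a word, which
  in general destroys the sorted order.\<close>

lemma Ck_on_integral:
  fixes G :: "real^'n::finite \<Rightarrow> real \<Rightarrow> complex"
  assumes S: "open S"
    and "\<And>\<tau>. \<tau> \<in> {p..q} \<Longrightarrow> Ck_on k S (\<lambda>y. G y \<tau>)"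
    and "\<And>ws. length ws \<le> k \<Longrightarrow> continuous_on (S \<times> {p..q}) (\<lambda>(y, \<tau>). D_word ws (\<lambda>y. G y \<tau>) y)"
  shows "Ck_on k S (\<lambda>y. integral {p..q} (G y))"
  using assms(2-)
proof (induction k arbitrary: G)
  case 0
  then show ?case using integral_continuous_on_param[of S p q G] 0(2)[of "[]"] by simp
next
  case (Suc k)
  have c0: "continuous_on (S \<times> {p..q}) (\<lambda>(y, \<tau>). G y \<tau>)" using Suc.prems(2)[of "[]"] by simp
  have c1: "continuous_on (S \<times> {p..q}) (\<lambda>(y, \<tau>). D_op i (\<lambda>y. G y \<tau>) y)" for i
    using Suc.prems(2)[of "[i]"] by simp
  have C1: "Ck_on 1 S (\<lambda>y. G y \<tau>)" if "\<tau> \<in> {p..q}" for \<tau>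
    using Ck_on_mono[OF Suc.prems(1)[OF that], of 1] by simp
  note D = D_op_integral[OF S _ C1 c0 c1]
  show ?case
  proof (rule Ck_on_SucI[OF S])
    show "continuous_on S (\<lambda>y. integral {p..q} (G y))"
      using integral_continuous_on_param[of S p q G] c0 by simp
  next
    fix i
    have "Ck_on k S (\<lambda>x. integral {p..q} (\<lambda>\<tau>. D_op i (\<lambda>y. G y \<tau>) x))"
    proof (rule Suc.IH)
      show "Ck_on k S (D_op i (\<lambda>y. G y \<tau>))" if "\<tau> \<in> {p..q}" for \<tau>
        by (rule Ck_on_D_op[OF S Suc.prems(1)[OF that]])
      show "continuous_on (S \<times> {p..q}) (\<lambda>(y, \<tau>). D_word ws (D_op i (\<lambda>y. G y \<tau>)) y)"
        if "length ws \<le> k" for ws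
        using Suc.prems(2)[of "ws @ [i]"] that by simp
    qed
    then show "Ck_on k S (D_op i (\<lambda>y. integral {p..q} (G y)))"
      by (rule Ck_on_cong[OF S, rotated]) (rule D(2)[symmetric])
  qed (rule D(1))
qed

lemma D_word_integral:
  fixes G :: "real^'n::finite \<Rightarrow> real \<Rightarrow> complex"
  assumes S: "open S" "x \<in> S"
    and Ck: "\<And>\<tau>. \<tau> \<in> {p..q} \<Longrightarrow> Ck_on (length ws) S (\<lambda>y. G y \<tau>)"
    and cont: "\<And>vs. length vs \<le> length ws \<Longrightarrow> continuous_on (S \<times> {p..q}) (\<lambda>(y, \<tau>). D_word vs (\<lambda>y. G y \<tau>) y)"
  shows "D_word ws (\<lambda>y. integral {p..q} (G y)) x = integral {p..q} (\<lambda>\<tau>. D_word ws (\<lambda>y. G y \<tau>) x)"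
  using assms(2-)
proof (induction ws arbitrary: x)
  case (Cons i ws)
  have IH: "D_word ws (\<lambda>y. integral {p..q} (G y)) y = integral {p..q} (\<lambda>\<tau>. D_word ws (\<lambda>y. G y \<tau>) y)"
    if "y \<in> S" for y
  proof (rule Cons.IH[OF that])
    show "Ck_on (length ws) S (\<lambda>y. G y \<tau>)" if "\<tau> \<in> {p..q}" for \<tau>
      by (rule Ck_on_mono[OF Cons.prems(2)[OF that]]) simp
  qed (use Cons.prems(3) in simp)
  have "D_word (i # ws) (\<lambda>y. integral {p..q} (G y)) x =
      D_op i (\<lambda>y. integral {p..q} (\<lambda>\<tau>. D_word ws (\<lambda>y. G y \<tau>) y)) x"
    using D_op_cong[OF S(1) Cons.prems(1) IH] by simp
  also have "\<dots> = integral {p..q} (\<lambda>\<tau>. D_op i (D_word ws (\<lambda>y. G y \<tau>)) x)"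
  proof (rule D_op_integral(2)[OF S(1) Cons.prems(1)])
    show "Ck_on 1 S (D_word ws (\<lambda>y. G y \<tau>))" if "\<tau> \<in> {p..q}" for \<tau>
      using Cons.prems(2)[OF that] by (intro Ck_on_D_word S(1)) simp
  qed (use Cons.prems(3)[of ws] Cons.prems(3)[of "i # ws"] in auto)
  finally show ?case by simp
qed simp

section \<open>Derivatives up to the boundary, and differential operators applied to time
  integrals\<close>

lemma continuous_on_slice:
  assumes "continuous_on (S \<times> T) (\<lambda>(x, t). F x t)" "t \<in> T"
  shows "continuous_on S (\<lambda>x. F x t)"
proof -
  have "continuous_on S (\<lambda>x. (x, t))" by (intro continuous_intros)
  from continuous_on_compose2[OF assms(1) this] show ?thesis using assms(2) by auto
qed

lemma continuous_on_slice':
  assumes "continuous_on (S \<times> T) (\<lambda>(x, t). F x t)" "x \<in> S"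
  shows "continuous_on T (\<lambda>t. F x t)"
proof -
  have "continuous_on T (\<lambda>t. (x, t))" by (intro continuous_intros)
  from continuous_on_compose2[OF assms(1) this] show ?thesis using assms(2) by auto
qed

text \<open>A point of the closure outside \<Omega> is a limit point of \<Omega>, so the
  \<open>Lim\<close> in \<open>D_closed\<close> is determined by any continuous extension of the
  interior derivative. All computations with boundary values go through this fact.\<close>

lemma D_closed_eqI:
  assumes "open \<Omega>" "continuous_on (closure \<Omega>) \<Phi>" "\<And>x. x \<in> \<Omega> \<Longrightarrow> D_multi \<alpha> g x = \<Phi> x" "x \<in> closure \<Omega>"
  shows "D_closed \<Omega> \<alpha> g x = \<Phi> x"
proof (cases "x \<in> \<Omega>")
  case False
  then have "x islimpt \<Omega>" using assms(4) by (simp add: closure_def)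
  then have nb: "at x within \<Omega> \<noteq> bot" by (simp add: trivial_limit_within)
  have "(\<Phi> \<longlongrightarrow> \<Phi> x) (at x within \<Omega>)"
    using assms(2,4) closure_subset unfolding continuous_on_def by (meson tendsto_within_subset)
  moreover have "\<forall>\<^sub>F y in at x within \<Omega>. \<Phi> y = D_multi \<alpha> g y"
    using assms(3) by (simp add: eventually_at_filter)
  ultimately have "(D_multi \<alpha> g \<longlongrightarrow> \<Phi> x) (at x within \<Omega>)"
    by (rule Lim_transform_eventually)
  from tendsto_Lim[OF nb this] show ?thesis using False by (simp add: D_closed_def)
qed (use assms in \<open>simp add: D_closed_def\<close>)

lemma D_closed_inside: "x \<in> \<Omega> \<Longrightarrow> D_closed \<Omega> \<alpha> g x = D_multi \<alpha> g x"
  by (simp add: D_closed_def)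

lemma D_closed_diff:
  assumes "open \<Omega>" "Ck_on k \<Omega> g" "Ck_on k \<Omega> h" "mlen \<alpha> \<le> k"
    and "continuous_on (closure \<Omega>) (D_closed \<Omega> \<alpha> g)" "continuous_on (closure \<Omega>) (D_closed \<Omega> \<alpha> h)"
    and "x \<in> closure \<Omega>"
  shows "D_closed \<Omega> \<alpha> (\<lambda>y. g y - h y) x = D_closed \<Omega> \<alpha> g x - D_closed \<Omega> \<alpha> h x"
proof (rule D_closed_eqI[OF assms(1)])
  show "continuous_on (closure \<Omega>) (\<lambda>x. D_closed \<Omega> \<alpha> g x - D_closed \<Omega> \<alpha> h x)"
    by (intro continuous_intros assms)
  show "D_multi \<alpha> (\<lambda>y. g y - h y) x = D_closed \<Omega> \<alpha> g x - D_closed \<Omega> \<alpha> h x" if "x \<in> \<Omega>" for x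
    using D_multi_lincomb[OF assms(1-3) that assms(4), of 1 "-1"] that by (simp add: D_closed_inside)
qed (rule assms(7))

lemma finite_mlen_le: "finite {\<alpha> :: 'n::finite \<Rightarrow> nat. mlen \<alpha> \<le> k}"
proof (rule finite_subset)
  have "\<alpha> i \<le> k" if "mlen \<alpha> \<le> k" for \<alpha> :: "'n \<Rightarrow> nat" and i
    using that member_le_sum[of i UNIV \<alpha>] by (simp add: mlen_def)
  then show "{\<alpha> :: 'n \<Rightarrow> nat. mlen \<alpha> \<le> k} \<subseteq> PiE UNIV (\<lambda>_. {..k})" by auto
  show "finite (PiE UNIV (\<lambda>_. {..k}) :: ('n \<Rightarrow> nat) set)" by (rule finite_PiE) auto
qed

text \<open>The time integral of \<open>D_closed\<close> is continuous on the closure and agrees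
  inside \<Omega> with the derivative of the time integral; hence it is also its boundary value. The
  order j and the coefficients c are left free so that one statement serves A and the boundary
  operators.\<close>

lemma Ck_closure_integral:
  fixes w :: "(real, 'n::{finite,linorder}) vec \<Rightarrow> real \<Rightarrow> complex"
  assumes \<Omega>: "open \<Omega>"
    and Ck: "\<And>\<tau>. \<tau> \<in> {p..q} \<Longrightarrow> Ck_on k \<Omega> (\<lambda>y. w y \<tau>)"
    and cont: "continuous_on (closure \<Omega> \<times> {p..q}) (\<lambda>(y, \<tau>). w y \<tau>)"
    and contD: "\<And>\<alpha>. mlen \<alpha> \<le> k \<Longrightarrow>
       continuous_on (closure \<Omega> \<times> {p..q}) (\<lambda>(y, \<tau>). D_closed \<Omega> \<alpha> (\<lambda>y. w y \<tau>) y)"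
  shows "Ck_closure k \<Omega> (\<lambda>y. integral {p..q} (w y))" (is "Ck_closure k \<Omega> ?Z")
    and "\<lbrakk>j \<le> k; x \<in> closure \<Omega>\<rbrakk> \<Longrightarrow> diff_op \<Omega> j c (\<lambda>y. integral {p..q} (w y)) x =
       integral {p..q} (\<lambda>\<tau>. diff_op \<Omega> j c (\<lambda>y. w y \<tau>) x)"
proof -
  have contW: "continuous_on (\<Omega> \<times> {p..q}) (\<lambda>(y, \<tau>). D_word ws (\<lambda>y. w y \<tau>) y)" if "length ws \<le> k" for ws
  proof -
    have "continuous_on (\<Omega> \<times> {p..q}) (\<lambda>(y, \<tau>). D_closed \<Omega> (count (mset ws)) (\<lambda>y. w y \<tau>) y)"
      by (rule continuous_on_subset[OF contD]) (use that mlen_count_mset[of ws] closure_subset in auto)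
    then show ?thesis
      by (rule continuous_on_eq) (use D_word_eq_D_multi[OF \<Omega> Ck _ that] in \<open>auto simp: D_closed_inside\<close>)
  qed
  have CkZ: "Ck_on k \<Omega> ?Z" by (rule Ck_on_integral[OF \<Omega> Ck contW])
  have contI: "continuous_on (closure \<Omega>) (\<lambda>x. integral {p..q} (\<lambda>\<tau>. D_closed \<Omega> \<alpha> (\<lambda>y. w y \<tau>) x))"
    if "mlen \<alpha> \<le> k" for \<alpha>
    using integral_continuous_on_param[of "closure \<Omega>" p q "\<lambda>x \<tau>. D_closed \<Omega> \<alpha> (\<lambda>y. w y \<tau>) x"] contD[OF that]
    by simp
  have D: "D_closed \<Omega> \<alpha> ?Z x = integral {p..q} (\<lambda>\<tau>. D_closed \<Omega> \<alpha> (\<lambda>y. w y \<tau>) x)"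
    if "mlen \<alpha> \<le> k" "x \<in> closure \<Omega>" for \<alpha> x
  proof (rule D_closed_eqI[OF \<Omega> contI[OF that(1)] _ that(2)])
    fix x assume x: "x \<in> \<Omega>"
    have l: "length (multi_word \<alpha>) \<le> k" using that by (simp add: length_multi_word)
    show "D_multi \<alpha> ?Z x = integral {p..q} (\<lambda>\<tau>. D_closed \<Omega> \<alpha> (\<lambda>y. w y \<tau>) x)"
      unfolding D_closed_inside[OF x] D_multi_eq_D_word
      using D_word_integral[OF \<Omega> x Ck_on_mono[OF Ck l] contW] l by simp
  qed
  show "Ck_closure k \<Omega> ?Z"
    unfolding Ck_closure_def
  proof (intro conjI allI impI CkZ)
    show "continuous_on (closure \<Omega>) ?Z"
      using integral_continuous_on_param[of "closure \<Omega>" p q w] cont by simp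
    show "continuous_on (closure \<Omega>) (D_closed \<Omega> \<alpha> ?Z)" if "mlen \<alpha> \<le> k" for \<alpha>
      by (rule continuous_on_eq[OF contI[OF that]]) (simp add: D that)
  qed
  show "diff_op \<Omega> j c ?Z x = integral {p..q} (\<lambda>\<tau>. diff_op \<Omega> j c (\<lambda>y. w y \<tau>) x)"
    if "j \<le> k" "x \<in> closure \<Omega>"
  proof -
    have "(\<lambda>\<tau>. c \<alpha> x * D_closed \<Omega> \<alpha> (\<lambda>y. w y \<tau>) x) integrable_on {p..q}" if "mlen \<alpha> \<le> j" for \<alpha>
    proof (rule integrable_continuous_real, intro continuous_intros)
      show "continuous_on {p..q} (\<lambda>\<tau>. D_closed \<Omega> \<alpha> (\<lambda>y. w y \<tau>) x)"
        using continuous_on_slice'[OF contD] that \<open>j \<le> k\<close> \<open>x \<in> closure \<Omega>\<close> by simp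
    qed
    then show ?thesis
      unfolding diff_op_def using that
      by (subst integral_sum) (auto simp: finite_mlen_le D intro!: sum.cong)
  qed
qed

section \<open>Linearity of the initial-boundary value problem\<close>

lemma frac_deriv_nonpos_diff:
  assumes "frac_deriv_nonpos_exists r h1" "frac_deriv_nonpos_exists r h2"
  shows "frac_deriv_nonpos_exists r (\<lambda>s. h1 s - h2 s)"
    and "t > 0 \<Longrightarrow> frac_deriv_nonpos r (\<lambda>s. h1 s - h2 s) t = frac_deriv_nonpos r h1 t - frac_deriv_nonpos r h2 t"
proof -
  show "frac_deriv_nonpos_exists r (\<lambda>s. h1 s - h2 s)"
    using assms unfolding frac_deriv_nonpos_exists_def diff_divide_distrib by (auto intro: set_integral_diff(1))
  show "frac_deriv_nonpos r (\<lambda>s. h1 s - h2 s) t = frac_deriv_nonpos r h1 t - frac_deriv_nonpos r h2 t" if "t > 0"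
    using assms that unfolding frac_deriv_nonpos_exists_def frac_deriv_nonpos_def RL_integral_def diff_divide_distrib
    by (auto simp: set_integral_diff(2) scaleR_diff_right)
qed

lemma frac_deriv_diff:
  assumes "\<rho> > 0" "frac_deriv_exists \<rho> h1" "frac_deriv_exists \<rho> h2"
  shows "frac_deriv_exists \<rho> (\<lambda>s. h1 s - h2 s)"
    and "t > 0 \<Longrightarrow> frac_deriv \<rho> (\<lambda>s. h1 s - h2 s) t = frac_deriv \<rho> h1 t - frac_deriv \<rho> h2 t"
proof -
  let ?F = "frac_deriv_nonpos (\<rho> - 1)"
  have ex: "frac_deriv_nonpos_exists (\<rho> - 1) h1" "frac_deriv_nonpos_exists (\<rho> - 1) h2"
    using assms unfolding frac_deriv_exists_def by auto
  \<comment> \<open>Additivity of the fractional integral is available at positive times, so the two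
    functions of t are compared on the open half line before differentiating.\<close>
  have "(?F (\<lambda>s. h1 s - h2 s) has_vector_derivative frac_deriv \<rho> h1 t - frac_deriv \<rho> h2 t) (at t)"
    if t: "t > 0" for t
  proof (rule has_vector_derivative_transform_within_open)
    have "(?F h has_vector_derivative frac_deriv \<rho> h t) (at t)" if "frac_deriv_exists \<rho> h" for h
      using that t assms(1) unfolding frac_deriv_exists_def frac_deriv_def by (simp add: vector_derivative_works)
    then show "((\<lambda>s. ?F h1 s - ?F h2 s) has_vector_derivative frac_deriv \<rho> h1 t - frac_deriv \<rho> h2 t) (at t)"
      using assms by (intro has_vector_derivative_diff) auto
  qed (use t frac_deriv_nonpos_diff(2)[OF ex] in \<open>auto intro: open_greaterThan[of 0]\<close>)
  note D = this
  show "frac_deriv_exists \<rho> (\<lambda>s. h1 s - h2 s)"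
    unfolding frac_deriv_exists_def using frac_deriv_nonpos_diff(1)[OF ex] D assms(1)
    by (auto intro: differentiableI_vector)
  show "frac_deriv \<rho> (\<lambda>s. h1 s - h2 s) t = frac_deriv \<rho> h1 t - frac_deriv \<rho> h2 t" if "t > 0"
    using vector_derivative_at[OF D[OF that]] assms(1) by (simp add: frac_deriv_def)
qed

lemma regular_solutionD:
  assumes "regular_solution \<rho> \<Omega> l a mj b f \<phi> u"
  shows "\<forall>x\<in>closure \<Omega>. frac_deriv_exists \<rho> (u x)"
    and "continuous_on (closure \<Omega> \<times> {0<..}) (\<lambda>(x, t). frac_deriv \<rho> (u x) t)"
    and "continuous_on (closure \<Omega> \<times> {0<..}) (\<lambda>(x, t). u x t)"
    and "\<forall>t>0. Ck_on (2 * l) \<Omega> (\<lambda>x. u x t)"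
    and "\<forall>\<alpha>. mlen \<alpha> \<le> 2 * l \<longrightarrow>
        continuous_on (closure \<Omega> \<times> {0<..}) (\<lambda>(x, t). D_closed \<Omega> \<alpha> (\<lambda>y. u y t) x)"
    and "\<exists>v. continuous_on (closure \<Omega> \<times> {0..}) (\<lambda>(x, t). v x t) \<and>
          (\<forall>x\<in>closure \<Omega>. \<forall>t>0. v x t = frac_deriv (\<rho> - 1) (u x) t)"
    and "\<forall>x\<in>\<Omega>. \<forall>t>0. frac_deriv \<rho> (u x) t + diff_op \<Omega> (2 * l) a (\<lambda>y. u y t) x = f x t"
    and "\<forall>x\<in>\<Omega>. (frac_deriv (\<rho> - 1) (u x) \<longlongrightarrow> \<phi> x) (at_right 0)"
    and "\<forall>j\<in>{1..l}. \<forall>x\<in>frontier \<Omega>. \<forall>t>0. diff_op \<Omega> (mj j) (b j) (\<lambda>y. u y t) x = 0"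
  using assms unfolding regular_solution_def by - (elim conjE, assumption)+

text \<open>The bound on \<open>mj\<close> keeps the boundary operators within the derivatives that
  extend continuously to the closure; that continuity is what makes \<open>D_closed\<close> additive
  at boundary points.\<close>

lemma regular_solution_diff:
  fixes u v :: "(real, 'n::{finite,linorder}) vec \<Rightarrow> real \<Rightarrow> complex"
  assumes \<rho>: "0 < \<rho>" "\<rho> \<le> 1" and \<Omega>: "open \<Omega>" and mj: "\<And>j. j \<in> {1..l} \<Longrightarrow> mj j \<le> 2 * l"
    and u: "regular_solution \<rho> \<Omega> l a mj b f \<phi> u"
    and v: "regular_solution \<rho> \<Omega> l a mj b f \<phi> v"
  shows "regular_solution \<rho> \<Omega> l a mj b (\<lambda>_ _. 0) (\<lambda>_. 0) (\<lambda>x t. u x t - v x t)"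
proof -
  note u' = regular_solutionD[OF u] and v' = regular_solutionD[OF v]
  have ex: "frac_deriv_exists \<rho> (u x)" "frac_deriv_exists \<rho> (v x)" if "x \<in> closure \<Omega>" for x
    using u'(1) v'(1) that by auto
  note fd = frac_deriv_diff[OF \<rho>(1) ex]
  have ex1: "frac_deriv_nonpos_exists (\<rho> - 1) (u x)" "frac_deriv_nonpos_exists (\<rho> - 1) (v x)" if "x \<in> closure \<Omega>" for x
    using ex[OF that] \<rho> unfolding frac_deriv_exists_def by auto
  have fd1: "frac_deriv (\<rho> - 1) (\<lambda>t. u x t - v x t) t = frac_deriv (\<rho> - 1) (u x) t - frac_deriv (\<rho> - 1) (v x) t"
    if "x \<in> closure \<Omega>" "t > 0" for x t
    using frac_deriv_nonpos_diff(2)[OF ex1[OF that(1)] that(2)] \<rho> by (simp add: frac_deriv_def)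
  have contD: "continuous_on (closure \<Omega> \<times> {0<..}) (\<lambda>(x, t). D_closed \<Omega> \<alpha> (\<lambda>y. u y t) x)"
    "continuous_on (closure \<Omega> \<times> {0<..}) (\<lambda>(x, t). D_closed \<Omega> \<alpha> (\<lambda>y. v y t) x)"
    if "mlen \<alpha> \<le> 2 * l" for \<alpha>
    using u'(5) v'(5) that by blast+
  have Ck: "Ck_on (2 * l) \<Omega> (\<lambda>x. u x t)" "Ck_on (2 * l) \<Omega> (\<lambda>x. v x t)" if "t > 0" for t
    using u'(4)[rule_format, OF that] v'(4)[rule_format, OF that] .
  have D: "D_closed \<Omega> \<alpha> (\<lambda>y. u y t - v y t) x = D_closed \<Omega> \<alpha> (\<lambda>y. u y t) x - D_closed \<Omega> \<alpha> (\<lambda>y. v y t) x"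
    if "mlen \<alpha> \<le> 2 * l" "t > 0" "x \<in> closure \<Omega>" for \<alpha> t x
    using that contD[OF that(1), THEN continuous_on_slice, of t]
    by (intro D_closed_diff[OF \<Omega> Ck]) auto
  have op: "diff_op \<Omega> k c (\<lambda>y. u y t - v y t) x = diff_op \<Omega> k c (\<lambda>y. u y t) x - diff_op \<Omega> k c (\<lambda>y. v y t) x"
    if "k \<le> 2 * l" "t > 0" "x \<in> closure \<Omega>" for k c t x
    unfolding diff_op_def using that by (simp add: D right_diff_distrib sum_subtractf)
  have in_closure: "x \<in> closure \<Omega>" if "x \<in> \<Omega>" for x using that closure_subset by auto
  show ?thesis
    unfolding regular_solution_def
  proof (intro conjI ballI allI impI)
    show "frac_deriv_exists \<rho> (\<lambda>t. u x t - v x t)" if "x \<in> closure \<Omega>" for x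
      using fd(1)[OF that that] .
    have "continuous_on (closure \<Omega> \<times> {0<..}) (\<lambda>z. (case z of (x, t) \<Rightarrow> frac_deriv \<rho> (u x) t) - (case z of (x, t) \<Rightarrow> frac_deriv \<rho> (v x) t))"
      by (intro continuous_on_diff u'(2) v'(2))
    then show "continuous_on (closure \<Omega> \<times> {0<..}) (\<lambda>(x, t). frac_deriv \<rho> (\<lambda>t. u x t - v x t) t)"
      by (rule continuous_on_eq) (auto simp: fd(2))
    have "continuous_on (closure \<Omega> \<times> {0<..}) (\<lambda>z. (case z of (x, t) \<Rightarrow> u x t) - (case z of (x, t) \<Rightarrow> v x t))"
      by (intro continuous_on_diff u'(3) v'(3))
    then show "continuous_on (closure \<Omega> \<times> {0<..}) (\<lambda>(x, t). u x t - v x t)"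
      by (simp add: split_beta)
    show "Ck_on (2 * l) \<Omega> (\<lambda>x. u x t - v x t)" if "t > 0" for t
      using Ck_on_lincomb[OF \<Omega> Ck[OF that], of 1 "-1"] by simp
    have "continuous_on (closure \<Omega> \<times> {0<..}) (\<lambda>z. (case z of (x, t) \<Rightarrow> D_closed \<Omega> \<alpha> (\<lambda>y. u y t) x) - (case z of (x, t) \<Rightarrow> D_closed \<Omega> \<alpha> (\<lambda>y. v y t) x))"
      if "mlen \<alpha> \<le> 2 * l" for \<alpha>
      using contD[OF that] by (intro continuous_on_diff) blast+
    then show "continuous_on (closure \<Omega> \<times> {0<..}) (\<lambda>(x, t). D_closed \<Omega> \<alpha> (\<lambda>y. u y t - v y t) x)"
      if "mlen \<alpha> \<le> 2 * l" for \<alpha>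
      by (rule continuous_on_eq) (use that in \<open>auto simp: D\<close>)
    obtain yu where yu: "continuous_on (closure \<Omega> \<times> {0..}) (\<lambda>(x, t). yu x t)"
      "\<forall>x\<in>closure \<Omega>. \<forall>t>0. yu x t = frac_deriv (\<rho> - 1) (u x) t" using u'(6) by blast
    obtain yv where yv: "continuous_on (closure \<Omega> \<times> {0..}) (\<lambda>(x, t). yv x t)"
      "\<forall>x\<in>closure \<Omega>. \<forall>t>0. yv x t = frac_deriv (\<rho> - 1) (v x) t" using v'(6) by blast
    have "continuous_on (closure \<Omega> \<times> {0..}) (\<lambda>z. (case z of (x, t) \<Rightarrow> yu x t) - (case z of (x, t) \<Rightarrow> yv x t))"
      by (intro continuous_on_diff yu(1) yv(1))
    then have "continuous_on (closure \<Omega> \<times> {0..}) (\<lambda>(x, t). yu x t - yv x t)"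
      by (simp add: split_beta)
    then show "\<exists>y. continuous_on (closure \<Omega> \<times> {0..}) (\<lambda>(x, t). y x t) \<and>
       (\<forall>x\<in>closure \<Omega>. \<forall>t>0. y x t = frac_deriv (\<rho> - 1) (\<lambda>t. u x t - v x t) t)"
      by (intro exI[of _ "\<lambda>x t. yu x t - yv x t"]) (use yu yv fd1 in auto)
    show "frac_deriv \<rho> (\<lambda>t. u x t - v x t) t + diff_op \<Omega> (2 * l) a (\<lambda>y. u y t - v y t) x = 0"
      if x: "x \<in> \<Omega>" and t: "t > 0" for x t
    proof -
      have "frac_deriv \<rho> (u x) t + diff_op \<Omega> (2 * l) a (\<lambda>y. u y t) x = f x t"
        "frac_deriv \<rho> (v x) t + diff_op \<Omega> (2 * l) a (\<lambda>y. v y t) x = f x t"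
        using u'(7) v'(7) x t by blast+
      then show ?thesis
        unfolding fd(2)[OF in_closure[OF x] in_closure[OF x] t] op[OF order_refl t in_closure[OF x]]
        by (metis add_diff_add diff_self)
    qed
    show "(frac_deriv (\<rho> - 1) (\<lambda>t. u x t - v x t) \<longlongrightarrow> 0) (at_right 0)" if x: "x \<in> \<Omega>" for x
    proof (rule Lim_transform_eventually)
      have "(frac_deriv (\<rho> - 1) (u x) \<longlongrightarrow> \<phi> x) (at_right 0)" "(frac_deriv (\<rho> - 1) (v x) \<longlongrightarrow> \<phi> x) (at_right 0)"
        using u'(8) v'(8) x by blast+
      from tendsto_diff[OF this]
      show "((\<lambda>t. frac_deriv (\<rho> - 1) (u x) t - frac_deriv (\<rho> - 1) (v x) t) \<longlongrightarrow> 0) (at_right 0)" by simp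
      show "\<forall>\<^sub>F t in at_right 0. frac_deriv (\<rho> - 1) (u x) t - frac_deriv (\<rho> - 1) (v x) t
         = frac_deriv (\<rho> - 1) (\<lambda>t. u x t - v x t) t"
        using fd1[OF in_closure[OF x]] by (simp add: eventually_at_filter)
    qed
    show "diff_op \<Omega> (mj j) (b j) (\<lambda>y. u y t - v y t) x = 0"
      if "j \<in> {1..l}" "x \<in> frontier \<Omega>" "t > 0" for j x t
    proof -
      have "x \<in> closure \<Omega>" using that by (simp add: frontier_def)
      moreover have "diff_op \<Omega> (mj j) (b j) (\<lambda>y. u y t) x = 0" "diff_op \<Omega> (mj j) (b j) (\<lambda>y. v y t) x = 0"
        using u'(9) v'(9) that by blast+
      ultimately show ?thesis using op[OF mj[OF that(1)] that(3), of x "b j"] by simp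
    qed
  qed
qed

section \<open>Positive definiteness of the fractional integral\<close>

text \<open>The solution of z' = y - \<sigma> z with z(0) = 0, written by variation of
  constants.\<close>

definition exp_conv :: "real \<Rightarrow> (real \<Rightarrow> 'a::euclidean_space) \<Rightarrow> real \<Rightarrow> 'a" where
  "exp_conv \<sigma> y t = integral {0..t} (\<lambda>s. exp (- \<sigma> * (t - s)) *\<^sub>R y s)"

text \<open>After extracting the factor exp(-\<sigma> t), t enters the remaining integral only as
  its upper limit, and the product rule applies.\<close>

lemma has_vector_derivative_exp_conv:
  fixes y :: "real \<Rightarrow> 'a::euclidean_space"
  assumes "continuous_on UNIV y" "t \<in> {0..T}"
  shows "(exp_conv \<sigma> y has_vector_derivative (y t - \<sigma> *\<^sub>R exp_conv \<sigma> y t)) (at t within {0..T})"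
proof -
  define J where "J t = integral {0..t} (\<lambda>s. exp (\<sigma> * s) *\<^sub>R y s)" for t
  have eq: "exp_conv \<sigma> y t = exp (- \<sigma> * t) *\<^sub>R J t" for t
    unfolding exp_conv_def J_def integral_cmul[symmetric]
    by (simp add: algebra_simps flip: exp_add)
  have J': "(J has_vector_derivative exp (\<sigma> * t) *\<^sub>R y t) (at t within {0..T})"
    unfolding J_def
    by (rule integral_has_vector_derivative)
       (use assms in \<open>auto intro!: continuous_intros continuous_on_subset[OF assms(1)]\<close>)
  have e': "((\<lambda>t. exp (- \<sigma> * t)) has_real_derivative (- \<sigma> * exp (- \<sigma> * t))) (at t within {0..T})"
    by (auto intro!: derivative_eq_intros)
  have "((\<lambda>t. exp (- \<sigma> * t) *\<^sub>R J t) has_vector_derivative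
      (exp (- \<sigma> * t) *\<^sub>R (exp (\<sigma> * t) *\<^sub>R y t) + (- \<sigma> * exp (- \<sigma> * t)) *\<^sub>R J t)) (at t within {0..T})"
    by (rule has_vector_derivative_scaleR[OF e' J'])
  also have "exp (- \<sigma> * t) *\<^sub>R (exp (\<sigma> * t) *\<^sub>R y t) = y t"
    by (simp flip: exp_add)
  finally show ?thesis unfolding eq[abs_def] by (simp add: eq)
qed

text \<open>The quadratic form of convolution with \<kappa>. The weight T - t amounts to integrating
  the unweighted forms on [0,T'] over T' from 0 to T.\<close>

definition weighted_form :: "real \<Rightarrow> (real \<Rightarrow> real) \<Rightarrow> (real \<Rightarrow> 'a::euclidean_space) \<Rightarrow> real" where
  "weighted_form T \<kappa> y =
     (LINT t:{0..T}|lborel. (T - t) * (y t \<bullet> (LINT s:{0..t}|lborel. \<kappa> (t - s) *\<^sub>R y s)))"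

text \<open>
  With \<open>z = exp_conv \<sigma> y\<close>, integrate the derivative of \<open>(T - t) \<bar>z\<bar>\<^sup>2\<close> using \<open>z' = y - \<sigma> z\<close>.  Without
  the weight \<open>T - t\<close>, the case \<open>\<sigma> = 0\<close> (that is, \<open>\<rho> = 1\<close>) would only yield \<open>z T = 0\<close>.
\<close>

lemma integral_exp_conv:
  fixes y :: "real \<Rightarrow> 'a::euclidean_space"
  assumes "continuous_on UNIV y" "0 < T" "0 \<le> \<sigma>"
  defines "E \<equiv> integral {0..T} (\<lambda>t. (T - t) * (y t \<bullet> exp_conv \<sigma> y t))"
  shows "E \<ge> 0" and "E = 0 \<Longrightarrow> t \<in> {0..T} \<Longrightarrow> y t = 0"
proof -
  let ?z = "exp_conv \<sigma> y"
  note z' = has_vector_derivative_exp_conv[OF assms(1), of _ T \<sigma>]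
  have cz: "continuous_on {0..T} ?z"
    using z' by (meson continuous_on_eq_continuous_within has_vector_derivative_continuous)
  have cy: "continuous_on {0..T} y" using assms(1) by (rule continuous_on_subset) auto
  have N': "((\<lambda>t. (T - t) * (?z t \<bullet> ?z t)) has_vector_derivative
      (2 * ((T - t) * (y t \<bullet> ?z t)) - ((?z t \<bullet> ?z t) + 2 * \<sigma> * ((T - t) * (?z t \<bullet> ?z t))))) (at t within {0..T})"
    if "t \<in> {0..T}" for t
  proof -
    have "((\<lambda>t. ?z t \<bullet> ?z t) has_vector_derivative
      (?z t \<bullet> (y t - \<sigma> *\<^sub>R ?z t) + (y t - \<sigma> *\<^sub>R ?z t) \<bullet> ?z t)) (at t within {0..T})"
      by (rule bounded_bilinear.has_vector_derivative[OF bounded_bilinear_inner z'[OF that] z'[OF that]])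
    moreover have "((\<lambda>t. T - t) has_real_derivative -1) (at t within {0..T})"
      by (auto intro!: derivative_eq_intros)
    ultimately have "((\<lambda>t. (T - t) *\<^sub>R (?z t \<bullet> ?z t)) has_vector_derivative
       ((T - t) *\<^sub>R (?z t \<bullet> (y t - \<sigma> *\<^sub>R ?z t) + (y t - \<sigma> *\<^sub>R ?z t) \<bullet> ?z t) + (-1) *\<^sub>R (?z t \<bullet> ?z t)))
       (at t within {0..T})"
      by (intro has_vector_derivative_scaleR)
    then show ?thesis by (simp add: inner_diff_right inner_diff_left inner_commute algebra_simps)
  qed
  define R where "R = (\<lambda>t. (?z t \<bullet> ?z t) + 2 * \<sigma> * ((T - t) * (?z t \<bullet> ?z t)))"
  have Rc: "continuous_on {0..T} R" unfolding R_def by (intro continuous_intros cz)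
  have Rnn: "R t \<ge> 0" if "t \<in> {0..T}" for t unfolding R_def using that assms(3) by auto
  \<comment> \<open>Both boundary terms vanish: the weight at T, and \<open>exp_conv\<close> at
    0.\<close>
  have "((\<lambda>t. 2 * ((T - t) * (y t \<bullet> ?z t)) - R t) has_integral
      ((T - T) * (?z T \<bullet> ?z T) - (T - 0) * (?z 0 \<bullet> ?z 0))) {0..T}"
    unfolding R_def using assms(2) N' by (intro fundamental_theorem_of_calculus) auto
  moreover have "?z 0 = 0" by (simp add: exp_conv_def)
  ultimately have "((\<lambda>t. 2 * ((T - t) * (y t \<bullet> ?z t)) - R t) has_integral 0) {0..T}" by simp
  moreover have "((\<lambda>t. 2 * ((T - t) * (y t \<bullet> ?z t))) has_integral 2 * E) {0..T}"
    unfolding E_def by (intro has_integral_mult_right integrable_integral integrable_continuous_real continuous_intros cy cz)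
  ultimately have "((\<lambda>t. 2 * ((T - t) * (y t \<bullet> ?z t)) - (2 * ((T - t) * (y t \<bullet> ?z t)) - R t)) has_integral 2 * E - 0) {0..T}"
    by (intro has_integral_diff)
  then have RE: "(R has_integral 2 * E) {0..T}" by simp
  show "E \<ge> 0" using has_integral_nonneg[OF RE Rnn] by simp
  show "y t = 0" if "E = 0" "t \<in> {0..T}"
  proof -
    have R0: "R t = 0" if "t \<in> {0..T}" for t
      using has_integral_0_cbox_imp_0[of 0 T R t] RE Rc Rnn \<open>E = 0\<close> that assms(2) by (auto simp: cbox_interval)
    have z0: "?z t = 0" if "t \<in> {0..T}" for t
    proof -
      have "0 \<le> 2 * \<sigma> * ((T - t) * (?z t \<bullet> ?z t))" using that assms(3) by auto
      then have "?z t \<bullet> ?z t \<le> 0" using R0[OF that] unfolding R_def by linarith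
      then show ?thesis by (metis inner_gt_zero_iff not_le)
    qed
    \<comment> \<open>Since z vanishes on the whole interval, so does z' = y - \<sigma> z, and
      therefore y.\<close>
    have "((\<lambda>t. 0) has_vector_derivative (y t - \<sigma> *\<^sub>R ?z t)) (at t within {0..T})"
      by (rule has_vector_derivative_transform[OF that(2) _ z'[OF that(2)]]) (simp add: z0)
    moreover have "((\<lambda>t. 0 :: 'a) has_vector_derivative 0) (at t within {0..T})" by simp
    ultimately have "y t - \<sigma> *\<^sub>R ?z t = 0"
      using vector_derivative_unique_within_closed_interval[of 0 T t] assms(2) that(2) by (metis cbox_interval)
    then show ?thesis using z0[OF that(2)] by simp
  qed
qed

section \<open>The quadratic form as a double integral over a triangle\<close>

lemma integrable_convolution_kernel:
  fixes a k :: "real \<Rightarrow> real"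
  assumes a: "integrable lborel a" and k: "integrable lborel k"
  shows "integrable (lborel \<Otimes>\<^sub>M lborel) (\<lambda>(t, s). a t * k (t - s))"
proof (rule lborel_pair.Fubini_integrable)
  have [measurable]: "a \<in> borel_measurable borel" "k \<in> borel_measurable borel" using a k by auto
  show "(\<lambda>(t, s). a t * k (t - s)) \<in> borel_measurable (lborel \<Otimes>\<^sub>M lborel)" by measurable
  have shift: "integrable lborel (\<lambda>s. g (t - s))" "(LINT s|lborel. g (t - s)) = integral\<^sup>L lborel g"
    if "integrable lborel g" for g :: "real \<Rightarrow> real" and t
    using lborel_integrable_real_affine[OF that, of "-1" t] lborel_integral_real_affine[of "-1" g t] by auto
  \<comment> \<open>By invariance under reflection and translation, the inner integral of \<bar>k(t
    - s)\<bar> does not depend on t.\<close>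
  have "(\<lambda>t. LINT s|lborel. norm (case (t, s) of (t, s) \<Rightarrow> a t * k (t - s))) =
      (\<lambda>t. \<bar>a t\<bar> * (LINT s|lborel. \<bar>k s\<bar>))"
    using shift(2)[of "\<lambda>s. \<bar>k s\<bar>"] k by (simp add: abs_mult)
  then show "integrable lborel (\<lambda>t. LINT s|lborel. norm (case (t, s) of (t, s) \<Rightarrow> a t * k (t - s)))"
    using a by simp
  show "AE t in lborel. integrable lborel (\<lambda>s. case (t, s) of (t, s) \<Rightarrow> a t * k (t - s))"
    using shift(1)[OF k] by simp
qed

text \<open>The integrand of \<open>weighted_form\<close> at p = (t, s), extended by 0 to the plane.
  The strict inequality s < t keeps the argument of \<kappa> positive, so that the Gamma integral
  below can be inserted at every point of the triangle.\<close>

definition form_integrand :: "real \<Rightarrow> (real \<Rightarrow> real) \<Rightarrow> (real \<Rightarrow> 'a::euclidean_space) \<Rightarrow> real \<times> real \<Rightarrow> real" where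
  "form_integrand T \<kappa> y p = (if 0 \<le> snd p \<and> snd p < fst p \<and> fst p \<le> T
     then (T - fst p) * (y (fst p) \<bullet> y (snd p)) * \<kappa> (fst p - snd p) else 0)"

text \<open>With M a bound for the norm of y on [0,T], the integrand is dominated by T * M * M, cut
  off to [0,T] in t, times \<bar>\<kappa>(t - s)\<bar> cut off to [0,T] in t - s; this is an
  integrable convolution kernel. Fubini then gives the value.\<close>

lemma
  fixes y :: "real \<Rightarrow> 'a::euclidean_space"
  assumes y: "continuous_on UNIV y" and T: "0 < T"
    and \<kappa>: "set_integrable lborel {0..T} \<kappa>" and [measurable]: "\<kappa> \<in> borel_measurable borel"
  shows integrable_form_integrand: "integrable (lborel \<Otimes>\<^sub>M lborel) (form_integrand T \<kappa> y)"
    and integral_form_integrand: "(LINT p|(lborel \<Otimes>\<^sub>M lborel). form_integrand T \<kappa> y p) = weighted_form T \<kappa> y"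
proof -
  have [measurable]: "y \<in> borel_measurable borel" using y by (rule borel_measurable_continuous_onI)
  have "compact (y ` {0..T})" by (rule compact_continuous_image[OF continuous_on_subset[OF y]]) auto
  then obtain M where M: "\<And>t. t \<in> {0..T} \<Longrightarrow> norm (y t) \<le> M"
    using compact_imp_bounded bounded_iff by (metis imageI)
  have M0: "M \<ge> 0" using M[of 0] T norm_ge_zero[of "y 0"] by (meson atLeastAtMost_iff less_imp_le order_refl order_trans)
  define k where "k r = indicator {0..T} r * \<bar>\<kappa> r\<bar>" for r
  have k: "integrable lborel k"
    using set_integrable_abs[OF \<kappa>] unfolding k_def set_integrable_def by simp
  have a: "integrable lborel (\<lambda>t. indicator {0..T} t * (T * (M * M)))"
    using T by (intro integrable_mult_left integrable_real_indicator) auto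
  show int: "integrable (lborel \<Otimes>\<^sub>M lborel) (form_integrand T \<kappa> y)"
  proof (rule Bochner_Integration.integrable_bound[OF integrable_convolution_kernel[OF a k]])
    show "form_integrand T \<kappa> y \<in> borel_measurable (lborel \<Otimes>\<^sub>M lborel)"
      unfolding form_integrand_def by measurable
    have "norm (form_integrand T \<kappa> y (t, s)) \<le> norm (indicator {0..T} t * (T * (M * M)) * k (t - s))" for t s
    proof (cases "0 \<le> s \<and> s < t \<and> t \<le> T")
      case True
      have "\<bar>y t \<bullet> y s\<bar> \<le> norm (y t) * norm (y s)" by (rule Cauchy_Schwarz_ineq2)
      also have "\<dots> \<le> M * M" using M True M0 by (intro mult_mono) auto
      finally have "\<bar>T - t\<bar> * \<bar>y t \<bullet> y s\<bar> * \<bar>\<kappa> (t - s)\<bar> \<le> T * (M * M) * \<bar>\<kappa> (t - s)\<bar>"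
        using True T by (intro mult_right_mono mult_mono) auto
      then show ?thesis using True T M0 by (simp add: form_integrand_def k_def abs_mult)
    next
      case False
      then have "form_integrand T \<kappa> y (t, s) = 0" by (auto simp: form_integrand_def)
      then show ?thesis by simp
    qed
    then show "AE p in lborel \<Otimes>\<^sub>M lborel. norm (form_integrand T \<kappa> y p) \<le>
        norm (case p of (t, s) \<Rightarrow> indicator {0..T} t * (T * (M * M)) * k (t - s))"
      by (auto simp del: real_norm_def)
  qed
  have *: "(LINT s|lborel. form_integrand T \<kappa> y (t, s)) =
      indicator {0..T} t *\<^sub>R ((T - t) * (y t \<bullet> (LINT s:{0..t}|lborel. \<kappa> (t - s) *\<^sub>R y s)))" for t
  proof (cases "t \<in> {0..T}")
    case True
    have shift: "integrable lborel (\<lambda>s. k (t - s))"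
      using lborel_integrable_real_affine[OF k, of "-1" t] by simp
    have si: "set_integrable lborel {0..t} (\<lambda>s. \<kappa> (t - s) *\<^sub>R y s)"
      unfolding set_integrable_def
    proof (rule Bochner_Integration.integrable_bound)
      show "integrable lborel (\<lambda>s. M * k (t - s))" using shift by simp
      have "norm (indicator {0..t} s *\<^sub>R \<kappa> (t - s) *\<^sub>R y s) \<le> norm (M * k (t - s))" for s
        using True M[of s] M0
        by (auto simp: k_def indicator_def abs_mult mult.commute intro!: mult_right_mono)
      then show "AE s in lborel. norm (indicator {0..t} s *\<^sub>R \<kappa> (t - s) *\<^sub>R y s) \<le> norm (M * k (t - s))" by simp
    qed measurable
    have "(LINT s|lborel. form_integrand T \<kappa> y (t, s)) =
       (LINT s|lborel. (T - t) * (y t \<bullet> (indicator {0..t} s *\<^sub>R (\<kappa> (t - s) *\<^sub>R y s))))"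
    proof (rule integral_cong_AE)
      \<comment> \<open>The two integrands can differ only at s = t, which
        \<open>form_integrand\<close> excludes.\<close>
      show "AE s in lborel. form_integrand T \<kappa> y (t, s) = (T - t) * (y t \<bullet> (indicator {0..t} s *\<^sub>R (\<kappa> (t - s) *\<^sub>R y s)))"
        using AE_lborel_singleton[of t] by eventually_elim (use True in \<open>auto simp: form_integrand_def indicator_def\<close>)
      show "(\<lambda>s. form_integrand T \<kappa> y (t, s)) \<in> borel_measurable lborel"
        unfolding form_integrand_def fst_conv snd_conv by measurable
      show "(\<lambda>s. (T - t) * (y t \<bullet> indicator {0..t} s *\<^sub>R \<kappa> (t - s) *\<^sub>R y s)) \<in> borel_measurable lborel"
        by measurable
    qed
    also have "\<dots> = (T - t) * (y t \<bullet> (LINT s|lborel. indicator {0..t} s *\<^sub>R (\<kappa> (t - s) *\<^sub>R y s)))"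
      unfolding integral_mult_right_zero using si by (simp only: set_integrable_def integral_inner_right)
    finally show ?thesis using True by (simp add: set_lebesgue_integral_def)
  next
    case False
    then have "form_integrand T \<kappa> y (t, s) = 0" for s by (auto simp: form_integrand_def)
    then show ?thesis using False by simp
  qed
  show "(LINT p|(lborel \<Otimes>\<^sub>M lborel). form_integrand T \<kappa> y p) = weighted_form T \<kappa> y"
    unfolding weighted_form_def set_lebesgue_integral_def
    using lborel_pair.integral_fst'[OF int] *[unfolded set_lebesgue_integral_def] by simp
qed

lemma weighted_form_exp:
  fixes y :: "real \<Rightarrow> 'a::euclidean_space"
  assumes y: "continuous_on UNIV y"
  shows "weighted_form T (\<lambda>r. exp (- \<sigma> * r)) y = integral {0..T} (\<lambda>t. (T - t) * (y t \<bullet> exp_conv \<sigma> y t))"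
proof -
  have c: "continuous_on S y" for S using y by (rule continuous_on_subset) auto
  have "(LINT s:{0..t}|lborel. exp (- \<sigma> * (t - s)) *\<^sub>R y s) = exp_conv \<sigma> y t" for t
    unfolding exp_conv_def
    by (intro set_borel_integral_eq_integral borel_integrable_atLeastAtMost' continuous_intros c)
  moreover have "continuous_on {0..T} (exp_conv \<sigma> y)"
    using has_vector_derivative_exp_conv[OF y, of _ T \<sigma>]
    by (meson continuous_on_eq_continuous_within has_vector_derivative_continuous)
  ultimately show ?thesis
    unfolding weighted_form_def
    by (simp, intro set_borel_integral_eq_integral borel_integrable_atLeastAtMost' continuous_intros c) simp
qed

text \<open>The substitution t = r \<sigma> in Euler's integral for Gamma(1 - \<rho>). Working with
  the nonnegative integral yields integrability and value at once.\<close>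

lemma
  assumes "\<rho> < 1" "0 < r"
  shows integrable_Gamma_kernel: "integrable lborel (\<lambda>\<sigma>::real. indicator {0..} \<sigma> * (\<sigma> powr (-\<rho>) * exp (- \<sigma> * r)))"
    and integral_Gamma_kernel: "(LINT \<sigma>|lborel. indicator {0..} \<sigma> * (\<sigma> powr (-\<rho>) * exp (- \<sigma> * r))) = Gamma (1 - \<rho>) * r powr (\<rho> - 1)"
proof -
  let ?f = "\<lambda>\<sigma>. indicator {0..} \<sigma> * (\<sigma> powr (-\<rho>) * exp (- \<sigma> * r))"
  have "ennreal (Gamma (1 - \<rho>)) = (\<integral>\<^sup>+t. ennreal (indicator {0..} t * t powr (-\<rho>) / exp t) \<partial>lborel)"
    using Gamma_conv_nn_integral_real[of "1 - \<rho>"] assms by simp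
  also have "\<dots> = ennreal \<bar>r\<bar> * (\<integral>\<^sup>+t. ennreal (indicator {0..} (0 + r * t) * (0 + r * t) powr (-\<rho>) / exp (0 + r * t)) \<partial>lborel)"
    using assms by (intro nn_integral_real_affine) auto
  also have "(\<integral>\<^sup>+t. ennreal (indicator {0..} (0 + r * t) * (0 + r * t) powr (-\<rho>) / exp (0 + r * t)) \<partial>lborel) =
     (\<integral>\<^sup>+t. ennreal (r powr (-\<rho>)) * ennreal (?f t) \<partial>lborel)"
    using assms by (intro nn_integral_cong)
      (auto simp: indicator_def powr_mult exp_minus field_simps zero_le_mult_iff simp flip: ennreal_mult)
  also have "\<dots> = ennreal (r powr (-\<rho>)) * (\<integral>\<^sup>+t. ennreal (?f t) \<partial>lborel)"
    by (intro nn_integral_cmult) auto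
  finally have 1: "ennreal (Gamma (1 - \<rho>)) = ennreal (r powr (1 - \<rho>)) * (\<integral>\<^sup>+t. ennreal (?f t) \<partial>lborel)"
    using assms by (simp add: powr_diff powr_minus field_simps flip: mult.assoc ennreal_mult)
  have "ennreal (r powr (\<rho> - 1)) * ennreal (Gamma (1 - \<rho>)) = (\<integral>\<^sup>+t. ennreal (?f t) \<partial>lborel)"
    unfolding 1 mult.assoc[symmetric] using assms
    by (simp flip: ennreal_mult powr_add)
  then have "(\<integral>\<^sup>+t. ennreal (?f t) \<partial>lborel) = ennreal (Gamma (1 - \<rho>) * r powr (\<rho> - 1))"
    using assms by (simp add: ennreal_mult' Gamma_real_nonneg mult.commute)
  moreover have "0 \<le> Gamma (1 - \<rho>) * r powr (\<rho> - 1)" using assms Gamma_real_pos[of "1 - \<rho>"] by simp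
  ultimately have "integrable lborel ?f \<and> integral\<^sup>L lborel ?f = Gamma (1 - \<rho>) * r powr (\<rho> - 1)"
    by (subst nn_integral_eq_integrable[symmetric]) auto
  then show "integrable lborel ?f" "integral\<^sup>L lborel ?f = Gamma (1 - \<rho>) * r powr (\<rho> - 1)" by auto
qed

lemma set_integrable_powr_from_0:
  fixes a c :: real
  assumes "a > -1"
  shows "set_integrable lborel {0..c} (\<lambda>x. x powr a)"
proof (cases "0 \<le> c")
  case True
  have "(\<lambda>x. x powr a) absolutely_integrable_on {0..c}"
    using integrable_on_powr_from_0[OF assms True] by (intro nonnegative_absolutely_integrable_1) auto
  then show ?thesis unfolding set_integrable_def by (subst (asm) integrable_completion) auto
qed (simp add: set_integrable_def)

lemma form_integrand_cmult: "form_integrand T (\<lambda>r. c * \<kappa> r) y p = c * form_integrand T \<kappa> y p"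
  by (simp add: form_integrand_def)

text \<open>Insert the Gamma integral for r powr (\<rho> - 1) into the double integral and exchange
  the order of \<sigma> and (t, s). Fubini applies because the \<sigma>-integral of \<bar>F\<bar> is
  a multiple of the absolute value of the integrand for r powr (\<rho> - 1), already known to be
  integrable.\<close>

lemma
  fixes y :: "real \<Rightarrow> 'a::euclidean_space"
  assumes y: "continuous_on UNIV y" and T: "0 < T" and \<rho>: "0 < \<rho>" "\<rho> < 1"
  defines "w \<equiv> \<lambda>\<sigma>. indicator {0..} \<sigma> * \<sigma> powr (-\<rho>) * weighted_form T (\<lambda>r. exp (- \<sigma> * r)) y"
  shows integrable_weighted_form_exp: "integrable lborel w"
    and integral_weighted_form_exp:
      "integral\<^sup>L lborel w = Gamma (1 - \<rho>) * weighted_form T (\<lambda>r. r powr (\<rho> - 1)) y"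
proof -
  have [measurable]: "y \<in> borel_measurable borel" using y by (rule borel_measurable_continuous_onI)
  let ?g = "\<lambda>\<sigma> r. indicator {0..} \<sigma> * (\<sigma> powr (-\<rho>) * exp (- \<sigma> * r)) :: real"
  define F where "F = (\<lambda>(p, \<sigma>). form_integrand T (?g \<sigma>) y p)"
  have Fm[measurable]: "F \<in> borel_measurable ((lborel \<Otimes>\<^sub>M lborel) \<Otimes>\<^sub>M lborel)"
    unfolding F_def form_integrand_def by measurable
  have ip: "set_integrable lborel {0..T} (\<lambda>r. r powr (\<rho> - 1))"
    using \<rho> by (intro set_integrable_powr_from_0) auto
  have ie: "set_integrable lborel {0..T} (\<lambda>r. exp (- \<sigma> * r))" for \<sigma>
    by (intro borel_integrable_atLeastAtMost' continuous_intros)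
  note fp = integrable_form_integrand[OF y T ip, simplified] integral_form_integrand[OF y T ip, simplified]
  note fe = integrable_form_integrand[OF y T ie, simplified] integral_form_integrand[OF y T ie, simplified]
  have sec: "integrable lborel (\<lambda>\<sigma>. F (p, \<sigma>))"
    "(LINT \<sigma>|lborel. F (p, \<sigma>)) = Gamma (1 - \<rho>) * form_integrand T (\<lambda>r. r powr (\<rho> - 1)) y p"
    "(LINT \<sigma>|lborel. norm (F (p, \<sigma>))) = Gamma (1 - \<rho>) * \<bar>form_integrand T (\<lambda>r. r powr (\<rho> - 1)) y p\<bar>" for p
  proof -
    define r where "r = fst p - snd p"
    have "integrable lborel (\<lambda>\<sigma>. F (p, \<sigma>)) \<and>
      (LINT \<sigma>|lborel. F (p, \<sigma>)) = Gamma (1 - \<rho>) * form_integrand T (\<lambda>r. r powr (\<rho> - 1)) y p \<and>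
      (LINT \<sigma>|lborel. norm (F (p, \<sigma>))) = Gamma (1 - \<rho>) * \<bar>form_integrand T (\<lambda>r. r powr (\<rho> - 1)) y p\<bar>"
    proof (cases "0 \<le> snd p \<and> snd p < fst p \<and> fst p \<le> T")
      case True
      then have r: "r > 0" by (simp add: r_def)
      let ?c = "(T - fst p) * (y (fst p) \<bullet> y (snd p))"
      have Fe: "F (p, \<sigma>) = ?c * ?g \<sigma> r" for \<sigma>
        using True by (simp add: F_def form_integrand_def r_def)
      have nF: "norm (F (p, \<sigma>)) = \<bar>?c\<bar> * ?g \<sigma> r" for \<sigma>
        unfolding Fe real_norm_def abs_mult[of ?c] by (simp add: abs_mult)
      show ?thesis unfolding nF Fe
        using integrable_Gamma_kernel[OF \<rho>(2) r] integral_Gamma_kernel[OF \<rho>(2) r] True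
        by (simp add: form_integrand_def r_def abs_mult)
    next
      case False
      then have "form_integrand T \<kappa> y p = 0" for \<kappa>
        unfolding form_integrand_def by (rule if_not_P)
      then show ?thesis by (simp add: F_def)
    qed
    then show "integrable lborel (\<lambda>\<sigma>. F (p, \<sigma>))"
    "(LINT \<sigma>|lborel. F (p, \<sigma>)) = Gamma (1 - \<rho>) * form_integrand T (\<lambda>r. r powr (\<rho> - 1)) y p"
    "(LINT \<sigma>|lborel. norm (F (p, \<sigma>))) = Gamma (1 - \<rho>) * \<bar>form_integrand T (\<lambda>r. r powr (\<rho> - 1)) y p\<bar>"
      by auto
  qed
  \<comment> \<open>Fubini is needed between the plane of the points (t, s) and the line of
    \<sigma>; sigma-finiteness of the plane is seen by identifying the product measure with
    \<open>lborel\<close> on pairs.\<close>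
  interpret P: pair_sigma_finite "lborel \<Otimes>\<^sub>M lborel :: (real \<times> real) measure" "lborel :: real measure"
    unfolding lborel_prod ..
  have Fint: "integrable ((lborel \<Otimes>\<^sub>M lborel) \<Otimes>\<^sub>M lborel) F"
  proof (rule P.Fubini_integrable[OF Fm])
    show "integrable (lborel \<Otimes>\<^sub>M lborel) (\<lambda>p. LINT \<sigma>|lborel. norm (F (p, \<sigma>)))"
      unfolding sec(3) using fp(1) by (intro integrable_mult_right integrable_abs)
  qed (simp add: sec(1))
  have wF: "w \<sigma> = (LINT p|(lborel \<Otimes>\<^sub>M lborel). F (p, \<sigma>))" for \<sigma>
  proof -
    have "F (p, \<sigma>) = (indicator {0..} \<sigma> * \<sigma> powr (-\<rho>)) * form_integrand T (\<lambda>r. exp (- \<sigma> * r)) y p" for p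
      unfolding F_def form_integrand_cmult[symmetric] by (simp add: mult.assoc)
    then show ?thesis unfolding w_def using fe(2)[of \<sigma>] by simp
  qed
  have F': "integrable ((lborel \<Otimes>\<^sub>M lborel) \<Otimes>\<^sub>M lborel) (case_prod (\<lambda>p \<sigma>. F (p, \<sigma>)))"
    using Fint by simp
  show "integrable lborel w"
    unfolding wF[abs_def] by (rule P.integrable_snd[OF F'])
  have "integral\<^sup>L lborel w = (LINT p|(lborel \<Otimes>\<^sub>M lborel). LINT \<sigma>|lborel. F (p, \<sigma>))"
    unfolding wF[abs_def] by (rule P.Fubini_integral[OF F'])
  also have "\<dots> = Gamma (1 - \<rho>) * weighted_form T (\<lambda>r. r powr (\<rho> - 1)) y"
    unfolding sec(2) using fp by simp
  finally show "integral\<^sup>L lborel w = Gamma (1 - \<rho>) * weighted_form T (\<lambda>r. r powr (\<rho> - 1)) y" .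
qed

text \<open>Strictness is inherited from a single exponential: if the form vanishes, so does the
  form of exp(-\<sigma> r) for at least one \<sigma> \<ge> 0, and this already forces y = 0 on
  [0,T].\<close>

proposition weighted_form_powr_pos:
  fixes y :: "real \<Rightarrow> 'a::euclidean_space"
  assumes y: "continuous_on UNIV y" and T: "0 < T" and \<rho>: "0 < \<rho>" "\<rho> \<le> 1"
  shows "weighted_form T (\<lambda>r. r powr (\<rho> - 1)) y \<ge> 0"
    and "weighted_form T (\<lambda>r. r powr (\<rho> - 1)) y = 0 \<Longrightarrow> t \<in> {0..T} \<Longrightarrow> y t = 0"
proof -
  let ?Q = "weighted_form T (\<lambda>r. r powr (\<rho> - 1)) y"
  let ?E = "\<lambda>\<sigma>. weighted_form T (\<lambda>r. exp (- \<sigma> * r)) y"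
  have E: "?E \<sigma> \<ge> 0" "?E \<sigma> = 0 \<Longrightarrow> t \<in> {0..T} \<Longrightarrow> y t = 0" if "\<sigma> \<ge> 0" for \<sigma> t
    unfolding weighted_form_exp[OF y] using integral_exp_conv[OF y T that] by auto
  \<comment> \<open>For \<open>\<rho> < 1\<close>, \<open>r powr (\<rho> - 1)\<close> is a superposition of the kernels \<open>exp (- \<sigma> r)\<close>; for \<open>\<rho> = 1\<close> it is the one with \<open>\<sigma> = 0\<close>.\<close>
  have "?Q \<ge> 0 \<and> (?Q = 0 \<longrightarrow> (\<exists>\<sigma>\<ge>0. ?E \<sigma> = 0))"
  proof (cases "\<rho> = 1")
    case True
    have [measurable]: "y \<in> borel_measurable borel" using y by (rule borel_measurable_continuous_onI)
    have "(LINT s:{0..t}|lborel. (t - s) powr (\<rho> - 1) *\<^sub>R y s) = (LINT s:{0..t}|lborel. exp (- 0 * (t - s)) *\<^sub>R y s)" for t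
      unfolding set_lebesgue_integral_def
    proof (rule integral_cong_AE)
      \<comment> \<open>For \<rho> = 1 the kernel is 1 except at s = t, where 0 powr 0 = 0 by
        convention.\<close>
      show "AE s in lborel. indicator {0..t} s *\<^sub>R (t - s) powr (\<rho> - 1) *\<^sub>R y s = indicator {0..t} s *\<^sub>R exp (- 0 * (t - s)) *\<^sub>R y s"
        using AE_lborel_singleton[of t] by eventually_elim (simp add: True)
    qed measurable
    then have "?Q = ?E 0" unfolding weighted_form_def by simp
    then show ?thesis using E[of 0] by force
  next
    case False
    then have \<rho>1: "\<rho> < 1" using \<rho> by simp
    let ?w = "\<lambda>\<sigma>. indicator {0..} \<sigma> * \<sigma> powr (-\<rho>) * ?E \<sigma>"
    note w = integrable_weighted_form_exp[OF y T \<rho>(1) \<rho>1] integral_weighted_form_exp[OF y T \<rho>(1) \<rho>1]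
    have w0: "?w \<sigma> \<ge> 0" for \<sigma> using E(1)[of \<sigma>] by (cases "\<sigma> \<ge> 0") auto
    have G: "Gamma (1 - \<rho>) > 0" using \<rho>1 by (simp add: Gamma_real_pos)
    have "0 \<le> integral\<^sup>L lborel ?w" using w0 by (intro Bochner_Integration.integral_nonneg) auto
    then have "?Q \<ge> 0" using w(2) G by (simp add: zero_le_mult_iff)
    moreover have "\<exists>\<sigma>\<ge>0. ?E \<sigma> = 0" if "?Q = 0"
    proof (rule ccontr)
      assume "\<not> ?thesis"
      \<comment> \<open>The endpoint \<sigma> = 0 is avoided because 0 powr (-\<rho>) = 0 makes the
        integrand vanish there regardless of the form; an open interval has positive measure and
        suffices.\<close>
      then have ne: "?w \<sigma> \<noteq> 0" if "\<sigma> \<in> {0<..<1}" for \<sigma> using that by auto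
      have "integral\<^sup>L lborel ?w = 0" using w(2) that by simp
      then have "AE \<sigma> in lborel. ?w \<sigma> = 0"
        using integral_nonneg_eq_0_iff_AE[OF w(1)] w0 by simp
      then have "AE \<sigma> in lborel. \<sigma> \<notin> {0<..<1::real}" by eventually_elim (use ne in auto)
      then have "{0<..<1::real} \<in> null_sets lborel" by (subst AE_iff_null_sets) auto
      then show False by (simp add: null_sets_def)
    qed
    ultimately show ?thesis by blast
  qed
  then show "?Q \<ge> 0" "?Q = 0 \<Longrightarrow> t \<in> {0..T} \<Longrightarrow> y t = 0" using E(2) by auto
qed

section \<open>Abel inversion\<close>

text \<open>The substitution s = r + (t - r) x leads to the Beta integral with parameters 1 - \<rho>
  and \<rho>, which sum to 1. The value is independent of r and t, and this is what makes Abel's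
  inversion work.\<close>

lemma
  fixes r t \<rho> :: real
  assumes \<rho>: "0 < \<rho>" "\<rho> < 1" and rt: "r < t"
  defines "\<kappa> \<equiv> \<lambda>s. indicator {r<..t} s * ((t - s) powr (\<rho> - 1) * (s - r) powr (-\<rho>))"
  shows integrable_Abel_kernel: "integrable lborel \<kappa>"
    and integral_Abel_kernel: "integral\<^sup>L lborel \<kappa> = Gamma \<rho> * Gamma (1 - \<rho>)"
proof -
  let ?g = "\<lambda>x::real. indicator {0..1} x *\<^sub>R (x powr (1 - \<rho> - 1) * (1 - x) powr (\<rho> - 1))"
  have B: "Beta (1 - \<rho>) \<rho> = Gamma \<rho> * Gamma (1 - \<rho>)"
    using \<rho> by (simp add: Beta_def)
  have gi: "integrable lborel ?g"
    using integrable_Beta[of "1 - \<rho>" \<rho>] \<rho> unfolding set_integrable_def by simp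
  have "integral\<^sup>L lborel ?g = Beta (1 - \<rho>) \<rho>"
    using set_borel_integral_eq_integral(2)[OF integrable_Beta[of "1 - \<rho>" \<rho>]]
      has_integral_Beta_real[of "1 - \<rho>" \<rho>] \<rho>
    by (simp add: set_lebesgue_integral_def integral_unique)
  then have gv: "integral\<^sup>L lborel ?g = Gamma \<rho> * Gamma (1 - \<rho>)" using B by simp
  \<comment> \<open>The exponents \<rho> - 1 and -\<rho> add up to -1, so scaling leaves the factor
    1 / (t - r), which later cancels the Jacobian. At x = 0 both sides are 0: the interval is open
    at r, and 0 powr (-\<rho>) = 0.\<close>
  have eq: "\<kappa> (r + (t - r) * x) = ?g x / (t - r)" for x
  proof -
    have iff: "r + (t - r) * x \<in> {r<..t} \<longleftrightarrow> 0 < x \<and> x \<le> 1"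
    proof -
      have "r + (t - r) * x \<le> t \<longleftrightarrow> (t - r) * x \<le> (t - r) * 1" by (simp add: algebra_simps)
      also have "\<dots> \<longleftrightarrow> x \<le> 1" using rt by (simp only: mult_le_cancel_left_pos diff_gt_0_iff_gt)
      finally show ?thesis using rt by (auto simp: zero_less_mult_iff)
    qed
    show ?thesis
    proof (cases "0 < x \<and> x \<le> 1")
      case True
      have 1: "t - (r + (t - r) * x) = (t - r) * (1 - x)" "r + (t - r) * x - r = (t - r) * x"
        by (simp_all add: algebra_simps)
      have "(t - r) powr (\<rho> - 1) * (t - r) powr (- \<rho>) = (t - r) powr (- 1)"
        by (simp flip: powr_add)
      also have "\<dots> = 1 / (t - r)" using rt by (simp add: powr_minus divide_inverse)
      finally have 2: "(t - r) powr (\<rho> - 1) * (t - r) powr (- \<rho>) = 1 / (t - r)" .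
      have "\<kappa> (r + (t - r) * x) = ((t - r) * (1 - x)) powr (\<rho> - 1) * ((t - r) * x) powr (-\<rho>)"
        using True iff unfolding \<kappa>_def 1 by simp
      also have "\<dots> = ((t - r) powr (\<rho> - 1) * (t - r) powr (- \<rho>)) * ((1 - x) powr (\<rho> - 1) * x powr (-\<rho>))"
        using True rt by (simp add: powr_mult)
      finally show ?thesis using True unfolding 2 by simp
    next
      case False
      then show ?thesis using iff by (auto simp: \<kappa>_def indicator_def)
    qed
  qed
  have "integrable lborel (\<lambda>x. \<kappa> (r + (t - r) * x))" unfolding eq using gi by simp
  then show "integrable lborel \<kappa>" using rt by (subst (asm) lborel_integrable_real_affine_iff) auto
  have "integral\<^sup>L lborel \<kappa> = (t - r) * integral\<^sup>L lborel (\<lambda>x. \<kappa> (r + (t - r) * x))"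
    using lborel_integral_real_affine[of "t - r" \<kappa> r] rt by simp
  also have "\<dots> = Gamma \<rho> * Gamma (1 - \<rho>)" unfolding eq using gv rt by simp
  finally show "integral\<^sup>L lborel \<kappa> = Gamma \<rho> * Gamma (1 - \<rho>)" .
qed

text \<open>Exchange the order of integration over the triangle 0 \<le> r < s \<le> t; for fixed r <
  t the inner integral is the constant of the Abel kernel.\<close>

lemma Abel_inversion:
  fixes h :: "real \<Rightarrow> 'a::euclidean_space"
  assumes \<rho>: "0 < \<rho>" "\<rho> < 1"
    and [measurable]: "h \<in> borel_measurable borel" and h: "set_integrable lborel {0..t} h"
  shows "(LINT s:{0..t}|lborel. (t - s) powr (\<rho> - 1) *\<^sub>R (LINT r:{0..s}|lborel. (s - r) powr (-\<rho>) *\<^sub>R h r))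
     = (Gamma \<rho> * Gamma (1 - \<rho>)) *\<^sub>R (LINT r:{0..t}|lborel. h r)"
proof -
  let ?B = "Gamma \<rho> * Gamma (1 - \<rho>)"
  have B0: "?B > 0" using \<rho> by (simp add: Gamma_real_pos)
  let ?k = "\<lambda>r s. indicator {r<..t} s * ((t - s) powr (\<rho> - 1) * (s - r) powr (-\<rho>))"
  define F where "F = (\<lambda>(r, s). if 0 \<le> r \<and> r < s \<and> s \<le> t
    then ((t - s) powr (\<rho> - 1) * (s - r) powr (-\<rho>)) *\<^sub>R h r else 0)"
  have Fm[measurable]: "F \<in> borel_measurable (lborel \<Otimes>\<^sub>M lborel)" unfolding F_def by measurable
  have Fr: "F (r, s) = (if 0 \<le> r \<and> r < t then ?k r s *\<^sub>R h r else 0)" for r s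
    by (auto simp: F_def indicator_def)
  have nF: "norm (F (r, s)) = (if 0 \<le> r \<and> r < t then norm (h r) * ?k r s else 0)" for r s
    unfolding Fr by (simp add: abs_mult)
  note K = integrable_Abel_kernel[OF \<rho>, of _ t] integral_Abel_kernel[OF \<rho>, of _ t]
  have Fint: "integrable (lborel \<Otimes>\<^sub>M lborel) F"
  proof (rule lborel_pair.Fubini_integrable[OF Fm])
    have *: "(LINT s|lborel. norm (F (r, s))) = (if 0 \<le> r \<and> r < t then norm (h r) * ?B else 0)" for r
      unfolding nF using K[of r] by (cases "0 \<le> r \<and> r < t") auto
    show "integrable lborel (\<lambda>r. LINT s|lborel. norm (F (r, s)))"
      unfolding *
    proof (rule Bochner_Integration.integrable_bound)
      show "integrable lborel (\<lambda>r. ?B *\<^sub>R (indicator {0..t} r *\<^sub>R h r))"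
        using h unfolding set_integrable_def by (intro integrable_scaleR_right) auto
    qed (auto simp: indicator_def abs_mult)
    have "integrable lborel (\<lambda>s. F (r, s))" for r
      unfolding Fr using K(1)[of r] by (cases "0 \<le> r \<and> r < t") auto
    then show "AE r in lborel. integrable lborel (\<lambda>s. F (r, s))" by simp
  qed
  have F': "integrable (lborel \<Otimes>\<^sub>M lborel) (case_prod (\<lambda>r s. F (r, s)))" using Fint by simp
  have "(LINT s|lborel. LINT r|lborel. F (r, s)) = (LINT r|lborel. LINT s|lborel. F (r, s))"
    by (rule lborel_pair.Fubini_integral[OF F'])
  also have "(LINT r|lborel. LINT s|lborel. F (r, s)) = (LINT r|lborel. ?B *\<^sub>R (indicator {0..t} r *\<^sub>R h r))"
  proof (rule integral_cong_AE)
    \<comment> \<open>At r = t the section of F is 0 while the right-hand side need not be; a single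
      point does not matter.\<close>
    have "(LINT s|lborel. F (r, s)) = ?B *\<^sub>R (indicator {0..t} r *\<^sub>R h r)" if "r \<noteq> t" for r
      unfolding Fr using K[of r] that by (cases "0 \<le> r \<and> r < t") (auto simp: indicator_def)
    then show "AE r in lborel. (LINT s|lborel. F (r, s)) = ?B *\<^sub>R (indicator {0..t} r *\<^sub>R h r)"
      using AE_lborel_singleton[of t] by (auto elim: eventually_mono)
  qed measurable
  also have "\<dots> = ?B *\<^sub>R (LINT r:{0..t}|lborel. h r)"
    unfolding set_lebesgue_integral_def by (rule integral_scaleR_right)
  also have "(LINT s|lborel. LINT r|lborel. F (r, s)) =
     (LINT s:{0..t}|lborel. (t - s) powr (\<rho> - 1) *\<^sub>R (LINT r:{0..s}|lborel. (s - r) powr (-\<rho>) *\<^sub>R h r))"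
    unfolding set_lebesgue_integral_def
  proof (intro Bochner_Integration.integral_cong refl)
    fix s
    have "F (r, s) = indicator {0..t} s *\<^sub>R ((t - s) powr (\<rho> - 1) *\<^sub>R (indicator {0..s} r *\<^sub>R ((s - r) powr (-\<rho>) *\<^sub>R h r)))" for r
      by (auto simp: F_def indicator_def)
    then show "(LINT r|lborel. F (r, s)) = indicator {0..t} s *\<^sub>R (t - s) powr (\<rho> - 1) *\<^sub>R
      (LINT r|lborel. indicator {0..s} r *\<^sub>R (s - r) powr (-\<rho>) *\<^sub>R h r)"
      by (simp only: integral_scaleR_right)
  qed
  finally show ?thesis .
qed

text \<open>\<open>\<Gamma>(\<rho>)\<close> times the fractional integral of order \<open>\<rho>\<close>.\<close>

definition Abel_op :: "real \<Rightarrow> (real \<Rightarrow> 'a::euclidean_space) \<Rightarrow> real \<Rightarrow> 'a" where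
  "Abel_op \<rho> y t = (LINT s:{0..t}|lborel. (t - s) powr (\<rho> - 1) *\<^sub>R y s)"

text \<open>Here y is the fractional integral of order 1 - \<rho> of h, so a further integration of
  order \<rho> gives the ordinary integral of h. For \<rho> = 1 the first operation is the identity
  and is treated separately.\<close>

lemma Abel_op_frac_deriv:
  assumes \<rho>: "0 < \<rho>" "\<rho> \<le> 1" and h: "continuous_on {0<..} h"
    and ex: "frac_deriv_nonpos_exists (\<rho> - 1) h"
    and y: "continuous_on {0..} y" "\<And>t. t > 0 \<Longrightarrow> y t = frac_deriv_nonpos (\<rho> - 1) h t" and t: "t > 0"
  shows "set_integrable lborel {0..t} h"
    and "Abel_op \<rho> y t = Gamma \<rho> *\<^sub>R (LINT s:{0..t}|lborel. h s)"
proof -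
  \<comment> \<open>Continuity of h is given on the open half line only. Cutting off to it produces
    a Borel function on the line that differs from h, on subsets of [0,\<infinity>), at most at
    0.\<close>
  define h' where "h' r = indicator {0<..} r *\<^sub>R h r" for r
  have h'm[measurable]: "h' \<in> borel_measurable borel"
    unfolding h'_def[abs_def] by (rule borel_measurable_continuous_on_indicator[OF _ h]) simp
  have hh': "AE r in lborel. indicator S r *\<^sub>R g r *\<^sub>R h r = indicator S r *\<^sub>R g r *\<^sub>R h' r" if "S \<subseteq> {0..}" for S and g :: "real \<Rightarrow> real"
    using AE_lborel_singleton[of 0] by eventually_elim (use that in \<open>auto simp: h'_def indicator_def\<close>)
  have hm[measurable]: "(\<lambda>r. indicator S r *\<^sub>R g r *\<^sub>R h r) \<in> borel_measurable borel"
    if [measurable]: "S \<in> sets borel" "g \<in> borel_measurable borel" and "S \<subseteq> {0..}" for S and g :: "real \<Rightarrow> real"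
  proof -
    have "(\<lambda>r. indicator S r *\<^sub>R g r *\<^sub>R h r) = (\<lambda>r. indicator S r *\<^sub>R g r *\<^sub>R h' r + indicator (S \<inter> {0}) r *\<^sub>R g r *\<^sub>R h 0)"
      using that(3) by (auto simp: fun_eq_iff h'_def indicator_def)
    also have "\<dots> \<in> borel_measurable borel" by measurable
    finally show ?thesis .
  qed
  show si: "set_integrable lborel {0..t} h"
  proof (cases "\<rho> = 1")
    case True
    have "set_integrable lborel {0..t} y"
      by (rule borel_integrable_atLeastAtMost', rule continuous_on_subset[OF y(1)]) auto
    moreover have "AE r in lborel. indicator {0..t} r *\<^sub>R h r = indicator {0..t} r *\<^sub>R y r"
      using AE_lborel_singleton[of 0]
      by eventually_elim (use y(2) True in \<open>auto simp: indicator_def frac_deriv_nonpos_def\<close>)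
    ultimately show ?thesis using hm[of "{0..t}" "\<lambda>_. 1"]
      unfolding set_integrable_def by (subst integrable_cong_AE) auto
  next
    case False
    have 1: "integrable lborel (\<lambda>r. indicator {0..t} r *\<^sub>R (h r / complex_of_real ((t - r) powr \<rho>)))"
      using ex False \<rho> t unfolding frac_deriv_nonpos_exists_def set_integrable_def by auto
    show ?thesis unfolding set_integrable_def
    \<comment> \<open>For 0 \<le> r < t the singular kernel is at least t powr (-\<rho>), so
      integrability against it implies that of h itself.\<close>
    proof (rule Bochner_Integration.integrable_bound[OF integrable_mult_right[OF 1, of "complex_of_real (t powr \<rho>)"]])
      have "norm (indicator {0..t} r *\<^sub>R h r) \<le> norm (complex_of_real (t powr \<rho>) * indicator {0..t} r *\<^sub>R (h r / complex_of_real ((t - r) powr \<rho>)))"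
        if "r \<noteq> t" for r
      proof (cases "r \<in> {0..t}")
        case True
        then have "0 < (t - r) powr \<rho>" "(t - r) powr \<rho> \<le> t powr \<rho>" using that \<rho> by (auto intro: powr_mono2)
        then have "norm (h r) * 1 \<le> norm (h r) * (t powr \<rho> / (t - r) powr \<rho>)"
          by (intro mult_left_mono) auto
        then show ?thesis using True by (simp add: norm_mult norm_divide mult.commute)
      qed simp
      then show "AE r in lborel. norm (indicator {0..t} r *\<^sub>R h r) \<le> norm (complex_of_real (t powr \<rho>) * indicator {0..t} r *\<^sub>R (h r / complex_of_real ((t - r) powr \<rho>)))"
        using AE_lborel_singleton[of t] by (auto elim: eventually_mono)
    qed (use hm[of "{0..t}" "\<lambda>_. 1"] in simp)
  qed
  show "Abel_op \<rho> y t = Gamma \<rho> *\<^sub>R (LINT s:{0..t}|lborel. h s)"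
  proof (cases "\<rho> = 1")
    case True
    have ym: "set_borel_measurable borel {0..t} y"
      unfolding set_borel_measurable_def
      by (rule borel_measurable_continuous_on_indicator) (auto intro: continuous_on_subset[OF y(1)])
    have "(LINT s:{0..t}|lborel. (t - s) powr (\<rho> - 1) *\<^sub>R y s) = (LINT s:{0..t}|lborel. h s)"
      unfolding set_lebesgue_integral_def
    proof (rule integral_cong_AE)
      have "(\<lambda>s. (t - s) powr (\<rho> - 1) *\<^sub>R (indicator {0..t} s *\<^sub>R y s)) \<in> borel_measurable lborel"
        using ym unfolding set_borel_measurable_def by measurable
      then show "(\<lambda>s. indicator {0..t} s *\<^sub>R (t - s) powr (\<rho> - 1) *\<^sub>R y s) \<in> borel_measurable lborel"
        by (simp add: mult.commute)
      show "AE s in lborel. indicator {0..t} s *\<^sub>R (t - s) powr (\<rho> - 1) *\<^sub>R y s = indicator {0..t} s *\<^sub>R h s"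
        using AE_lborel_singleton[of t] AE_lborel_singleton[of 0]
        by eventually_elim (use y(2) True in \<open>auto simp: indicator_def frac_deriv_nonpos_def\<close>)
    qed (use hm[of "{0..t}" "\<lambda>_. 1"] in simp)
    then show ?thesis using True by (simp add: Abel_op_def)
  next
    case False
    then have \<rho>1: "\<rho> < 1" using \<rho> by simp
    have G: "Gamma (1 - \<rho>) > 0" using \<rho>1 by (simp add: Gamma_real_pos)
    let ?I = "\<lambda>s. LINT r:{0..s}|lborel. (s - r) powr (-\<rho>) *\<^sub>R h' r"
    have ys: "y s = (1 / Gamma (1 - \<rho>)) *\<^sub>R ?I s" if "s > 0" for s
    proof -
      have e: "h r / complex_of_real ((s - r) powr \<rho>) = (s - r) powr (-\<rho>) *\<^sub>R h r" for r
        by (simp add: powr_minus scaleR_conv_of_real divide_inverse mult.commute)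
      have "y s = (1 / Gamma (1 - \<rho>)) *\<^sub>R (LINT r:{0..s}|lborel. (s - r) powr (-\<rho>) *\<^sub>R h r)"
        unfolding y(2)[OF that] frac_deriv_nonpos_def RL_integral_def using \<rho>1 e by simp
      also have "(LINT r:{0..s}|lborel. (s - r) powr (-\<rho>) *\<^sub>R h r) = ?I s"
        unfolding set_lebesgue_integral_def
      proof (rule integral_cong_AE)
        show "(\<lambda>r. indicator {0..s} r *\<^sub>R (s - r) powr (-\<rho>) *\<^sub>R h r) \<in> borel_measurable lborel"
          unfolding measurable_lborel2 by (rule hm) auto
        show "AE r in lborel. indicator {0..s} r *\<^sub>R (s - r) powr (-\<rho>) *\<^sub>R h r =
            indicator {0..s} r *\<^sub>R (s - r) powr (-\<rho>) *\<^sub>R h' r"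
          by (rule hh') auto
      qed measurable
      finally show ?thesis .
    qed
    have h'i: "set_integrable lborel {0..t} h'" "(LINT s:{0..t}|lborel. h' s) = (LINT s:{0..t}|lborel. h s)"
    proof -
      show "set_integrable lborel {0..t} h'"
        using si hh'[of "{0..t}" "\<lambda>_. 1"] hm[of "{0..t}" "\<lambda>_. 1"] unfolding set_integrable_def
        by (subst (asm) integrable_cong_AE[where g = "\<lambda>r. indicator {0..t} r *\<^sub>R h' r"]) auto
      show "(LINT s:{0..t}|lborel. h' s) = (LINT s:{0..t}|lborel. h s)"
        using hh'[of "{0..t}" "\<lambda>_. 1"] hm[of "{0..t}" "\<lambda>_. 1"] unfolding set_lebesgue_integral_def
        by (intro integral_cong_AE) (auto elim: eventually_mono)
    qed
    have "(LINT s:{0..t}|lborel. (t - s) powr (\<rho> - 1) *\<^sub>R y s) =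
       (LINT s|lborel. (1 / Gamma (1 - \<rho>)) *\<^sub>R (indicator {0..t} s *\<^sub>R (t - s) powr (\<rho> - 1) *\<^sub>R ?I s))"
      unfolding set_lebesgue_integral_def[of _ "{0..t}"]
    proof (rule integral_cong_AE)
      have ym: "set_borel_measurable borel {0..t} y"
        unfolding set_borel_measurable_def
        by (rule borel_measurable_continuous_on_indicator) (auto intro: continuous_on_subset[OF y(1)])
      have "(\<lambda>s. (t - s) powr (\<rho> - 1) *\<^sub>R (indicator {0..t} s *\<^sub>R y s)) \<in> borel_measurable lborel"
        using ym unfolding set_borel_measurable_def by measurable
      then show "(\<lambda>s. indicator {0..t} s *\<^sub>R (t - s) powr (\<rho> - 1) *\<^sub>R y s) \<in> borel_measurable lborel"
        by (simp add: mult.commute)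
      show "AE s in lborel. indicator {0..t} s *\<^sub>R (t - s) powr (\<rho> - 1) *\<^sub>R y s =
         (1 / Gamma (1 - \<rho>)) *\<^sub>R (indicator {0..t} s *\<^sub>R (t - s) powr (\<rho> - 1) *\<^sub>R ?I s)"
        using AE_lborel_singleton[of 0] by eventually_elim (auto simp: indicator_def ys)
      \<comment> \<open>The limit s of integration is moved into the integrand, so that
        measurability in s follows from joint measurability in (s, r).\<close>
      have "(\<lambda>s. LINT r|lborel. (if 0 \<le> r \<and> r \<le> s then (s - r) powr (-\<rho>) *\<^sub>R h' r else 0)) \<in> borel_measurable lborel"
        by measurable
      also have "(\<lambda>s. LINT r|lborel. (if 0 \<le> r \<and> r \<le> s then (s - r) powr (-\<rho>) *\<^sub>R h' r else 0)) = ?I"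
        unfolding set_lebesgue_integral_def by (intro ext Bochner_Integration.integral_cong) (auto simp: indicator_def)
      finally have [measurable]: "?I \<in> borel_measurable lborel" .
      show "(\<lambda>s. (1 / Gamma (1 - \<rho>)) *\<^sub>R (indicator {0..t} s *\<^sub>R (t - s) powr (\<rho> - 1) *\<^sub>R ?I s)) \<in> borel_measurable lborel"
        by measurable
    qed
    also have "\<dots> = (1 / Gamma (1 - \<rho>)) *\<^sub>R (LINT s:{0..t}|lborel. (t - s) powr (\<rho> - 1) *\<^sub>R ?I s)"
      unfolding set_lebesgue_integral_def[of _ "{0..t}"] by (rule integral_scaleR_right)
    also have "\<dots> = Gamma \<rho> *\<^sub>R (LINT s:{0..t}|lborel. h s)"
      unfolding Abel_inversion[OF \<rho>(1) \<rho>1 h'm h'i(1)] h'i(2) using G by simp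
    finally show ?thesis by (simp add: Abel_op_def)
  qed
qed

text \<open>The interval starts at \<epsilon> > 0 because this integral will also be differentiated
  in x, and the spatial derivatives of a regular solution are jointly continuous only for positive
  times.\<close>

lemma Abel_op_increment:
  assumes \<rho>: "0 < \<rho>" "\<rho> \<le> 1" and h: "continuous_on {0<..} h"
    and ex: "frac_deriv_nonpos_exists (\<rho> - 1) h"
    and y: "continuous_on {0..} y" "\<And>t. t > 0 \<Longrightarrow> y t = frac_deriv_nonpos (\<rho> - 1) h t" and t: "0 < \<epsilon>" "\<epsilon> \<le> t"
  shows "Gamma \<rho> *\<^sub>R integral {\<epsilon>..t} h = Abel_op \<rho> y t - Abel_op \<rho> y \<epsilon>"
proof -
  have t0: "0 < t" using t by simp
  have I: "set_integrable lborel {0..r} h" "Abel_op \<rho> y r = Gamma \<rho> *\<^sub>R (LINT s:{0..r}|lborel. h s)"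
    if "0 < r" for r
    using Abel_op_frac_deriv[OF \<rho> h ex y(1) _ that] y(2) by blast+
  have "integral {0..\<epsilon>} h + integral {\<epsilon>..t} h = integral {0..t} h"
    using t set_borel_integral_eq_integral(1)[OF I(1)[OF t0]] by (intro Henstock_Kurzweil_Integration.integral_combine) auto
  moreover have "(LINT s:{0..r}|lborel. h s) = integral {0..r} h" if "0 < r" for r
    by (rule set_borel_integral_eq_integral(2)[OF I(1)[OF that]])
  ultimately have "integral {\<epsilon>..t} h = (LINT s:{0..t}|lborel. h s) - (LINT s:{0..\<epsilon>}|lborel. h s)"
    using t0 t(1) by (simp add: eq_diff_eq add.commute)
  then show ?thesis
    unfolding I(2)[OF t0] I(2)[OF t(1)] by (simp add: scaleR_diff_right)
qed

section \<open>Uniqueness\<close>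

text \<open>The kernel has total mass t powr \<rho> / \<rho>. The bound provides domination in x,
  the limit 0 as t tends to 0, and vanishing for y = 0.\<close>

lemma norm_Abel_op_le:
  fixes y :: "real \<Rightarrow> 'a::euclidean_space"
  assumes \<rho>: "0 < \<rho>" and t: "0 \<le> t" and y: "\<And>s. s \<in> {0..t} \<Longrightarrow> norm (y s) \<le> M"
  shows "norm (Abel_op \<rho> y t) \<le> M * (t powr \<rho> / \<rho>)"
proof -
  have M0: "M \<ge> 0" using y[of t] t norm_ge_zero[of "y t"] by (meson atLeastAtMost_iff order_refl order_trans)
  let ?k = "\<lambda>r. indicator {0..t} r *\<^sub>R (r powr (\<rho> - 1))"
  have si: "set_integrable lborel {0..t} (\<lambda>r. r powr (\<rho> - 1))"
    using \<rho> by (intro set_integrable_powr_from_0) auto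
  then have ki: "integrable lborel ?k" by (simp add: set_integrable_def)
  have kv: "integral\<^sup>L lborel ?k = t powr \<rho> / \<rho>"
    using set_borel_integral_eq_integral(2)[OF si] has_integral_powr_from_0[of "\<rho> - 1" t] \<rho> t
    by (simp add: set_lebesgue_integral_def integral_unique)
  have k': "integrable lborel (\<lambda>s. ?k (t - s))" "(LINT s|lborel. ?k (t - s)) = t powr \<rho> / \<rho>"
    using lborel_integrable_real_affine[OF ki, of "-1" t] lborel_integral_real_affine[of "-1" ?k t] kv by auto
  have "norm (Abel_op \<rho> y t) \<le> (LINT s|lborel. norm (indicator {0..t} s *\<^sub>R (t - s) powr (\<rho> - 1) *\<^sub>R y s))"
    unfolding Abel_op_def set_lebesgue_integral_def by (rule integral_norm_bound)
  also have "\<dots> \<le> (LINT s|lborel. M * ?k (t - s))"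
  proof (rule integral_mono')
    show "integrable lborel (\<lambda>s. M * ?k (t - s))" using k'(1) by simp
    show "norm (indicator {0..t} s *\<^sub>R (t - s) powr (\<rho> - 1) *\<^sub>R y s) \<le> M * ?k (t - s)" for s
      using mult_left_mono[OF y[of s], of "(t - s) powr (\<rho> - 1)"] by (auto simp: indicator_def mult.commute)
    show "0 \<le> M * ?k (t - s)" for s using M0 by simp
  qed
  also have "\<dots> = M * (t powr \<rho> / \<rho>)" using k'(2) by simp
  finally show ?thesis .
qed

lemma integral_eq_0_imp_0:
  fixes h :: "real \<Rightarrow> 'a::euclidean_space"
  assumes h: "continuous_on {0<..} h" and I: "\<And>\<epsilon> t. 0 < \<epsilon> \<Longrightarrow> \<epsilon> \<le> t \<Longrightarrow> integral {\<epsilon>..t} h = 0" and t: "t > 0"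
  shows "h t = 0"
proof -
  have "((\<lambda>u. integral {t..u} h) has_vector_derivative h t) (at t within {t..t + 1})"
    by (rule integral_has_vector_derivative, rule continuous_on_subset[OF h]) (use t in auto)
  then have "((\<lambda>u. 0) has_vector_derivative h t) (at t within {t..t + 1})"
    by (rule has_vector_derivative_transform[rotated 2]) (use I t in auto)
  moreover have "((\<lambda>u. 0 :: 'a) has_vector_derivative 0) (at t within {t..t + 1})" by simp
  ultimately show ?thesis
    using vector_derivative_unique_within_closed_interval[of t "t + 1" t "\<lambda>u. 0 :: 'a" "h t" 0]
    by (simp add: cbox_interval)
qed

lemma AE_eq_0_imp_eq_0_on_open:
  fixes g :: "'a::euclidean_space \<Rightarrow> 'b::real_normed_vector"
  assumes "open S" "continuous_on S g" "AE x in lborel. x \<in> S \<longrightarrow> g x = 0" "x \<in> S"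
  shows "g x = 0"
proof (rule ccontr)
  assume "g x \<noteq> 0"
  define U where "U = S \<inter> g -` (- {0})"
  have U: "open U" unfolding U_def using assms(1,2) by (intro continuous_open_preimage) auto
  have "x \<in> U" using assms(4) \<open>g x \<noteq> 0\<close> by (simp add: U_def)
  have "AE x in lborel. x \<notin> U" using assms(3) by eventually_elim (auto simp: U_def)
  then have "U \<in> null_sets lborel" using U by (subst AE_iff_null_sets) auto
  then have "negligible U" by (simp add: negligible_iff_null_sets null_sets_completionI)
  then show False using open_not_negligible[OF U] \<open>x \<in> U\<close> by auto
qed

lemma homogeneous_solution_eq_0:
  fixes w :: "(real, 'n::{finite,linorder}) vec \<Rightarrow> real \<Rightarrow> complex"
  assumes \<rho>: "0 < \<rho>" "\<rho> \<le> 1" and \<Omega>: "open \<Omega>" "bounded \<Omega>"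
    and mj: "\<And>j. j \<in> {1..l} \<Longrightarrow> mj j \<le> 2 * l"
    and pos: "symmetric_positive \<Omega> l a mj b"
    and w: "regular_solution \<rho> \<Omega> l a mj b (\<lambda>_ _. 0) (\<lambda>_. 0) w"
    and xt: "x \<in> \<Omega>" "t > 0"
  shows "w x t = 0"
proof -
  note w' = regular_solutionD[OF w]
  define K where "K = closure \<Omega>"
  have K: "compact K" using \<Omega> by (simp add: K_def compact_closure)
  have KB[measurable]: "K \<in> sets borel" using K by (simp add: borel_compact)
  have \<Omega>B[measurable]: "\<Omega> \<in> sets borel" using \<Omega> by simp
  have \<Omega>K: "\<Omega> \<subseteq> K" by (simp add: K_def closure_subset)
  obtain y where yc: "continuous_on (K \<times> {0..}) (\<lambda>(x, t). y x t)"
    and yf: "\<And>x t. x \<in> K \<Longrightarrow> t > 0 \<Longrightarrow> y x t = frac_deriv (\<rho> - 1) (w x) t"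
    using w'(6) unfolding K_def by blast
  have y0: "y x 0 = 0" if "x \<in> \<Omega>" for x
  proof -
    have "(y x \<longlongrightarrow> y x 0) (at 0 within {0..})"
      using continuous_on_slice'[OF yc, of x] that \<Omega>K by (auto simp: continuous_on_def)
    then have "(y x \<longlongrightarrow> y x 0) (at_right 0)" by (rule tendsto_within_subset) auto
    moreover have "\<forall>\<^sub>F t in at_right 0. y x t = frac_deriv (\<rho> - 1) (w x) t"
      using yf that \<Omega>K by (auto simp: eventually_at_filter)
    ultimately have "(frac_deriv (\<rho> - 1) (w x) \<longlongrightarrow> y x 0) (at_right 0)"
      by (rule Lim_transform_eventually)
    moreover have "(frac_deriv (\<rho> - 1) (w x) \<longlongrightarrow> 0) (at_right 0)" using w'(8) that by blast
    ultimately show ?thesis using tendsto_unique trivial_limit_at_right_real by blast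
  qed
  \<comment> \<open>y is frozen at its initial value for negative times and set to 0 outside K: then
    Y is jointly Borel measurable and each \<open>Y x\<close> is continuous on the whole line, as
    the lemmas on quadratic forms demand. V is Gamma(\<rho>) times the time integral of w.\<close>
  define Y where "Y x s = indicator K x *\<^sub>R y x (max 0 s)" for x s
  define V where "V x = Abel_op \<rho> (Y x)" for x
  have yc': "continuous_on (K \<times> UNIV) (\<lambda>p. y (fst p) (max 0 (snd p)))"
  proof -
    have "continuous_on (K \<times> UNIV) (\<lambda>p. (fst p, max 0 (snd p :: real)))" by (intro continuous_intros)
    moreover have "(\<lambda>p. (fst p, max 0 (snd p :: real))) ` (K \<times> UNIV) \<subseteq> K \<times> {0..}" by auto
    ultimately show ?thesis
      using continuous_on_compose2[OF yc, of "K \<times> UNIV" "\<lambda>p. (fst p, max 0 (snd p :: real))"] by simp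
  qed
  have Ym: "(\<lambda>p. Y (fst p) (snd p)) \<in> borel_measurable (borel \<Otimes>\<^sub>M borel)"
  proof -
    have "K \<times> (UNIV :: real set) \<in> sets borel" by (intro borel_closed closed_Times closed_UNIV compact_imp_closed[OF K])
    then have "(\<lambda>p. indicator (K \<times> UNIV) p *\<^sub>R y (fst p) (max 0 (snd p :: real))) \<in> borel_measurable borel"
      by (rule borel_measurable_continuous_on_indicator[OF _ yc'])
    also have "(\<lambda>p. indicator (K \<times> UNIV) p *\<^sub>R y (fst p) (max 0 (snd p :: real))) = (\<lambda>p. Y (fst p) (snd p))"
      by (auto simp: Y_def indicator_def fun_eq_iff)
    finally show ?thesis by (simp add: borel_prod)
  qed
  note [measurable] = measurable_compose[OF measurable_Pair Ym, unfolded fst_conv snd_conv]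
  have Vm: "(\<lambda>p. V (fst p) (snd p)) \<in> borel_measurable (borel \<Otimes>\<^sub>M borel)"
  proof -
    have "(\<lambda>p. LINT s|lborel. (if 0 \<le> s \<and> s \<le> snd p then (snd p - s) powr (\<rho> - 1) *\<^sub>R Y (fst p) s else 0))
       \<in> borel_measurable (borel \<Otimes>\<^sub>M borel)" by measurable
    also have "(\<lambda>p. LINT s|lborel. (if 0 \<le> s \<and> s \<le> snd p then (snd p - s) powr (\<rho> - 1) *\<^sub>R Y (fst p) s else 0))
       = (\<lambda>p. V (fst p) (snd p))"
      unfolding V_def Abel_op_def set_lebesgue_integral_def
      by (intro ext Bochner_Integration.integral_cong) (auto simp: indicator_def)
    finally show ?thesis .
  qed
  note [measurable] = measurable_compose[OF measurable_Pair Vm, unfolded fst_conv snd_conv]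
  have YK: "continuous_on K (\<lambda>x. Y x s)" for s
  proof -
    have "continuous_on K (\<lambda>x. (x, s))" by (intro continuous_intros)
    from continuous_on_compose2[OF yc' this] have "continuous_on K (\<lambda>x. y x (max 0 s))" by auto
    then show ?thesis by (rule continuous_on_eq) (simp add: Y_def)
  qed
  have YR: "continuous_on UNIV (Y x)" for x
  proof (cases "x \<in> K")
    case True
    have "continuous_on UNIV (\<lambda>s :: real. (x, s))" by (intro continuous_intros)
    from continuous_on_compose2[OF yc' this] True have "continuous_on UNIV (\<lambda>s. y x (max 0 s))" by auto
    then show ?thesis using True by (simp add: Y_def[abs_def])
  qed (simp add: Y_def[abs_def])
  have ex: "frac_deriv_nonpos_exists (\<rho> - 1) (w x)"
    "t > 0 \<Longrightarrow> (frac_deriv_nonpos (\<rho> - 1) (w x) has_vector_derivative frac_deriv \<rho> (w x) t) (at t)"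
    if "x \<in> K" for x t
    using w'(1) that \<rho> unfolding K_def frac_deriv_exists_def frac_deriv_def by (auto simp: vector_derivative_works)
  have Yf: "Y x t = frac_deriv_nonpos (\<rho> - 1) (w x) t" if "x \<in> K" "t > 0" for x t
    using yf[OF that] that \<rho> by (simp add: Y_def frac_deriv_def)
  have Y0: "Y x 0 = 0" if "x \<in> \<Omega>" for x using y0[OF that] by (simp add: Y_def)
  have wc: "continuous_on {0<..} (w x)" if "x \<in> K" for x
    using continuous_on_slice'[OF w'(3)] that by (simp add: K_def)
  have inc: "Gamma \<rho> *\<^sub>R integral {\<epsilon>..t} (w x) = V x t - V x \<epsilon>" if "x \<in> K" "0 < \<epsilon>" "\<epsilon> \<le> t" for x \<epsilon> t
    unfolding V_def
    using Abel_op_increment[OF \<rho> wc[OF that(1)] ex(1)[OF that(1)] continuous_on_subset[OF YR] _ that(2,3)] Yf[OF that(1)]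
    by blast
  have G0: "Gamma \<rho> > 0" using \<rho> by (simp add: Gamma_real_pos)

  \<comment> \<open>Positivity of \<open>A\<close> on \<open>Z = \<integral>\<^sub>\<epsilon>\<^sup>t w\<close>, for which \<open>A Z = -(Y(t) - Y(\<epsilon>))\<close>.\<close>
  have energy: "(LINT x:\<Omega>|lborel. (Y x t - Y x \<epsilon>) \<bullet> (V x t - V x \<epsilon>)) \<le> 0" if \<epsilon>t: "0 < \<epsilon>" "\<epsilon> \<le> t" for \<epsilon> t
  proof -
    define Z where "Z x = integral {\<epsilon>..t} (w x)" for x
    have sub: "S \<times> {\<epsilon>..t} \<subseteq> S \<times> {0<..}" for S :: "(real, 'n) vec set" using \<epsilon>t by auto
    have Ckw: "Ck_on (2 * l) \<Omega> (\<lambda>y. w y \<tau>)" if "\<tau> \<in> {\<epsilon>..t}" for \<tau>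
      using w'(4) that \<epsilon>t by (meson atLeastAtMost_iff less_le_trans)
    have cD: "continuous_on (closure \<Omega> \<times> {\<epsilon>..t}) (\<lambda>(x, t). D_closed \<Omega> \<alpha> (\<lambda>y. w y t) x)"
      if "mlen \<alpha> \<le> 2 * l" for \<alpha>
      using w'(5) that sub by (meson continuous_on_subset)
    have cw: "continuous_on (closure \<Omega> \<times> {\<epsilon>..t}) (\<lambda>(x, t). w x t)"
      by (rule continuous_on_subset[OF w'(3) sub])
    have CZ: "Ck_closure (2 * l) \<Omega> Z"
      unfolding Z_def[abs_def] by (rule Ck_closure_integral(1)[OF \<Omega>(1) Ckw cw cD])
    have opZ: "diff_op \<Omega> j c Z x = integral {\<epsilon>..t} (\<lambda>\<tau>. diff_op \<Omega> j c (\<lambda>y. w y \<tau>) x)"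
      if "j \<le> 2 * l" "x \<in> closure \<Omega>" for j c x
      unfolding Z_def[abs_def] by (rule Ck_closure_integral(2)[OF \<Omega>(1) Ckw cw cD that])
    have Zdom: "Z \<in> operator_domain \<Omega> l mj b"
      unfolding operator_domain_def mem_Collect_eq
    proof (intro conjI ballI)
      show "Ck_closure (2 * l) \<Omega> Z" by (rule CZ)
      fix j x assume j: "j \<in> {1..l}" and x: "x \<in> frontier \<Omega>"
      have xc: "x \<in> closure \<Omega>" using x by (simp add: frontier_def)
      have "diff_op \<Omega> (mj j) (b j) Z x = integral {\<epsilon>..t} (\<lambda>\<tau>. diff_op \<Omega> (mj j) (b j) (\<lambda>y. w y \<tau>) x)"
        by (rule opZ[OF mj[OF j] xc])
      also have "\<dots> = integral {\<epsilon>..t} (\<lambda>\<tau>. 0)"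
        using w'(9) j x \<epsilon>t by (intro Henstock_Kurzweil_Integration.integral_cong) auto
      finally show "diff_op \<Omega> (mj j) (b j) Z x = 0" by simp
    qed
    have AZ: "diff_op \<Omega> (2 * l) a Z x = - (Y x t - Y x \<epsilon>)" if x: "x \<in> \<Omega>" for x
    proof -
      have xK: "x \<in> K" using x \<Omega>K by auto
      have "diff_op \<Omega> (2 * l) a Z x = integral {\<epsilon>..t} (\<lambda>\<tau>. diff_op \<Omega> (2 * l) a (\<lambda>y. w y \<tau>) x)"
        using xK by (intro opZ) (simp_all add: K_def)
      also have "\<dots> = integral {\<epsilon>..t} (\<lambda>\<tau>. - frac_deriv \<rho> (w x) \<tau>)"
        using w'(7) x \<epsilon>t by (intro Henstock_Kurzweil_Integration.integral_cong) (auto simp: add_eq_0_iff)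
      also have "\<dots> = - integral {\<epsilon>..t} (frac_deriv \<rho> (w x))" by simp
      also have "(frac_deriv \<rho> (w x) has_integral
          frac_deriv_nonpos (\<rho> - 1) (w x) t - frac_deriv_nonpos (\<rho> - 1) (w x) \<epsilon>) {\<epsilon>..t}"
        using \<epsilon>t ex(2)[OF xK]
        by (intro fundamental_theorem_of_calculus) (auto intro: has_vector_derivative_at_within)
      then have "integral {\<epsilon>..t} (frac_deriv \<rho> (w x)) = Y x t - Y x \<epsilon>"
        using Yf[OF xK] \<epsilon>t by (simp add: integral_unique)
      finally show ?thesis .
    qed
    have ZK: "continuous_on K Z" using CZ by (simp add: K_def Ck_closure_def)
    define g where "g x = - (Y x t - Y x \<epsilon>) * cnj (Z x)" for x
    have "continuous_on K g" unfolding g_def[abs_def] by (intro continuous_intros YK ZK)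
    then have "set_integrable lborel K g" unfolding set_integrable_def
      by (rule borel_integrable_compact[OF K])
    then have gi: "set_integrable lborel \<Omega> g" by (rule set_integrable_subset) (use \<Omega>K in auto)
    have L: "L2_inner \<Omega> (diff_op \<Omega> (2 * l) a Z) Z = (LINT x:\<Omega>|lborel. g x)"
      unfolding L2_inner_def set_lebesgue_integral_def
      by (intro Bochner_Integration.integral_cong) (auto simp: AZ g_def indicator_def)
    have "0 \<le> Re (LINT x:\<Omega>|lborel. g x)"
    \<comment> \<open>\<open>symmetric_positive\<close> asserts strict positivity for functions that
      do not vanish on \<Omega>; otherwise the integrand is 0.\<close>
    proof (cases "\<exists>x\<in>\<Omega>. Z x \<noteq> 0")
      case True
      then have "Re (L2_inner \<Omega> (diff_op \<Omega> (2 * l) a Z) Z) > 0"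
        using pos Zdom unfolding symmetric_positive_def by blast
      then show ?thesis by (simp add: L)
    next
      case False
      then have "(LINT x:\<Omega>|lborel. g x) = (LINT x:\<Omega>|lborel. 0)"
        unfolding set_lebesgue_integral_def by (intro Bochner_Integration.integral_cong) (auto simp: g_def indicator_def)
      then show ?thesis by simp
    qed
    also have "Re (LINT x:\<Omega>|lborel. g x) = (LINT x|lborel. Re (indicator \<Omega> x *\<^sub>R g x))"
      using gi unfolding set_lebesgue_integral_def set_integrable_def by (rule integral_Re[symmetric])
    \<comment> \<open>The factor Gamma(\<rho>) turns Z into the increment of V, and the real part of
      the product with a conjugate is the real inner product on the complex plane.\<close>
    finally have "0 \<le> Gamma \<rho> * (LINT x|lborel. Re (indicator \<Omega> x *\<^sub>R g x))" using G0 by simp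
    also have "\<dots> = (LINT x|lborel. - (indicator \<Omega> x *\<^sub>R ((Y x t - Y x \<epsilon>) \<bullet> (V x t - V x \<epsilon>))))"
      unfolding integral_mult_right_zero[symmetric]
    proof (intro Bochner_Integration.integral_cong refl)
      fix x
      show "Gamma \<rho> * Re (indicator \<Omega> x *\<^sub>R g x) = - (indicator \<Omega> x *\<^sub>R ((Y x t - Y x \<epsilon>) \<bullet> (V x t - V x \<epsilon>)))"
      proof (cases "x \<in> \<Omega>")
        case True
        then have "V x t - V x \<epsilon> = Gamma \<rho> *\<^sub>R Z x" using inc[OF _ \<epsilon>t, of x] \<Omega>K by (auto simp: Z_def)
        then show ?thesis using True by (simp add: g_def inner_complex_def algebra_simps)
      qed simp
    qed
    finally show ?thesis by (simp add: set_lebesgue_integral_def)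
  qed

  have bound: "\<exists>M. \<forall>x. \<forall>s\<in>{0..T}. norm (Y x s) \<le> M" for T
  proof -
    have "compact ((\<lambda>(x, s). y x s) ` (K \<times> {0..T}))"
      by (intro compact_continuous_image continuous_on_subset[OF yc] compact_Times K compact_Icc Sigma_mono) simp_all
    then obtain M where M: "\<And>z. z \<in> (\<lambda>(x, s). y x s) ` (K \<times> {0..T}) \<Longrightarrow> norm z \<le> M"
      using compact_imp_bounded[THEN iffD1[OF bounded_iff]] by meson
    have "norm (Y x s) \<le> \<bar>M\<bar>" if "s \<in> {0..T}" for x s
    proof (cases "x \<in> K")
      case True
      then have "norm (y x s) \<le> M" using that by (intro M) force
      then show ?thesis using that True by (simp add: Y_def max_def)
    qed (simp add: Y_def)
    then show ?thesis by blast
  qed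

  have form: "(LINT x:\<Omega>|lborel. Y x t \<bullet> V x t) \<le> 0" if t: "0 < t" for t
  proof -
    obtain M where M: "\<And>x s. s \<in> {0..t} \<Longrightarrow> norm (Y x s) \<le> M" using bound[of t] by blast
    have Vb: "norm (V x s) \<le> M * (s powr \<rho> / \<rho>)" if "s \<in> {0..t}" for x s
      unfolding V_def using M that \<rho> by (intro norm_Abel_op_le) auto
    have M0: "M \<ge> 0" using M[of 0 undefined] t norm_ge_zero by (meson atLeastAtMost_iff less_imp_le order_refl order_trans)
    define C where "C = M * (t powr \<rho> / \<rho>)"
    have VC: "norm (V x s) \<le> C" if "s \<in> {0..t}" for x s
    proof -
      have "s powr \<rho> \<le> t powr \<rho>" using that \<rho> by (intro powr_mono2) auto
      then have "M * (s powr \<rho> / \<rho>) \<le> C" unfolding C_def using M0 \<rho> by (intro mult_left_mono divide_right_mono) auto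
      then show ?thesis using Vb[OF that] by (meson order_trans)
    qed
    define e where "e n = t / real (Suc n)" for n
    have e: "0 < e n" "e n \<le> t" for n using t by (auto simp: e_def field_simps)
    have e0: "e \<longlonglongrightarrow> 0" unfolding e_def[abs_def] by (rule LIMSEQ_Suc[OF lim_const_over_n])
    \<comment> \<open>Passage \<epsilon> \<rightarrow> 0 in \<open>energy\<close> along t / (n + 1):
      on \<Omega> both Y and V tend to 0 at time 0, and on the bounded set \<Omega> the increments
      are dominated by 2 M and 2 C.\<close>
    have lim: "(\<lambda>n. LINT x|lborel. indicator \<Omega> x *\<^sub>R ((Y x t - Y x (e n)) \<bullet> (V x t - V x (e n))))
        \<longlonglongrightarrow> (LINT x|lborel. indicator \<Omega> x *\<^sub>R (Y x t \<bullet> V x t))"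
    proof (rule integral_dominated_convergence)
      show "integrable lborel (\<lambda>x. indicator \<Omega> x *\<^sub>R ((2 * M) * (2 * C)))"
        using \<Omega> emeasure_bounded_finite[of \<Omega>]
        by (intro integrable_scaleR_left integrable_real_indicator) (auto simp: less_top)
      show "AE x in lborel. (\<lambda>n. indicator \<Omega> x *\<^sub>R ((Y x t - Y x (e n)) \<bullet> (V x t - V x (e n)))) \<longlonglongrightarrow> indicator \<Omega> x *\<^sub>R (Y x t \<bullet> V x t)"
      proof (intro AE_I2)
        fix x
        show "(\<lambda>n. indicator \<Omega> x *\<^sub>R ((Y x t - Y x (e n)) \<bullet> (V x t - V x (e n)))) \<longlonglongrightarrow> indicator \<Omega> x *\<^sub>R (Y x t \<bullet> V x t)"
        proof (cases "x \<in> \<Omega>")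
          case True
          have "isCont (Y x) 0" using YR[of x] by (simp add: continuous_on_eq_continuous_at)
          then have 1: "(\<lambda>n. Y x (e n)) \<longlonglongrightarrow> 0" using isCont_tendsto_compose[OF _ e0] Y0[OF True] by metis
          have 2: "(\<lambda>n. V x (e n)) \<longlonglongrightarrow> 0"
          proof (rule Lim_null_comparison)
            show "\<forall>\<^sub>F n in sequentially. norm (V x (e n)) \<le> M * (e n powr \<rho> / \<rho>)"
              using Vb e by (intro always_eventually) (auto intro: less_imp_le)
            have "(\<lambda>n. e n powr \<rho>) \<longlonglongrightarrow> 0"
              using \<rho> e by (intro tendsto_zero_powrI[OF e0 tendsto_const]) (auto intro!: always_eventually less_imp_le)
            from tendsto_mult_left[OF tendsto_divide[OF this tendsto_const[of \<rho>]], of M]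
            show "(\<lambda>n. M * (e n powr \<rho> / \<rho>)) \<longlonglongrightarrow> 0" using \<rho> by simp
          qed
          have "(\<lambda>n. (Y x t - Y x (e n)) \<bullet> (V x t - V x (e n))) \<longlonglongrightarrow> (Y x t - 0) \<bullet> (V x t - 0)"
            by (intro tendsto_intros 1 2)
          then show ?thesis using True by simp
        qed simp
      qed
      show "AE x in lborel. norm (indicator \<Omega> x *\<^sub>R ((Y x t - Y x (e n)) \<bullet> (V x t - V x (e n)))) \<le> indicator \<Omega> x *\<^sub>R ((2 * M) * (2 * C))" for n
      proof (intro AE_I2)
        fix x
        have "norm (Y x t - Y x (e n)) \<le> norm (Y x t) + norm (Y x (e n))" by (rule norm_triangle_ineq4)
        also have "\<dots> \<le> 2 * M" using M[of t x] M[of "e n" x] e[of n] t by auto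
        finally have 1: "norm (Y x t - Y x (e n)) \<le> 2 * M" .
        have "norm (V x t - V x (e n)) \<le> norm (V x t) + norm (V x (e n))" by (rule norm_triangle_ineq4)
        also have "\<dots> \<le> 2 * C" using VC[of t x] VC[of "e n" x] e[of n] t by auto
        finally have 2: "norm (V x t - V x (e n)) \<le> 2 * C" .
        have "\<bar>(Y x t - Y x (e n)) \<bullet> (V x t - V x (e n))\<bar> \<le> norm (Y x t - Y x (e n)) * norm (V x t - V x (e n))"
          by (rule Cauchy_Schwarz_ineq2)
        also have "\<dots> \<le> (2 * M) * (2 * C)" using 1 2 M0 by (intro mult_mono) auto
        finally show "norm (indicator \<Omega> x *\<^sub>R ((Y x t - Y x (e n)) \<bullet> (V x t - V x (e n)))) \<le> indicator \<Omega> x *\<^sub>R ((2 * M) * (2 * C))"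
          by (simp add: indicator_def)
      qed
    qed measurable
    show ?thesis
      using LIMSEQ_le_const2[OF lim] energy[OF e, unfolded set_lebesgue_integral_def]
      unfolding set_lebesgue_integral_def by blast
  qed

  have Y_zero: "Y x t = 0" if "x \<in> \<Omega>" "0 \<le> t" for x t
  proof -
    \<comment> \<open>Any T \<ge> t with T > 0 would do; adding 1 also covers t = 0.\<close>
    define T where "T = t + 1"
    have T: "0 < T" "t \<in> {0..T}" using that by (auto simp: T_def)
    obtain M where M: "\<And>x s. s \<in> {0..T} \<Longrightarrow> norm (Y x s) \<le> M" using bound[of T] by blast
    have M0: "M \<ge> 0" using M[of 0 undefined] T norm_ge_zero by (meson atLeastAtMost_iff less_imp_le order_refl order_trans)
    define C where "C = M * (T powr \<rho> / \<rho>)"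
    have VC: "norm (V x s) \<le> C" if "s \<in> {0..T}" for x s
    proof -
      have "norm (V x s) \<le> M * (s powr \<rho> / \<rho>)"
        unfolding V_def using M that \<rho> by (intro norm_Abel_op_le) auto
      also have "s powr \<rho> \<le> T powr \<rho>" using that \<rho> by (intro powr_mono2) auto
      then have "M * (s powr \<rho> / \<rho>) \<le> C" unfolding C_def using M0 \<rho> by (intro mult_left_mono divide_right_mono) auto
      finally show ?thesis .
    qed
    define Q where "Q x = weighted_form T (\<lambda>r. r powr (\<rho> - 1)) (Y x)" for x
    note Qp = weighted_form_powr_pos[OF YR T(1) \<rho>, folded Q_def]
    \<comment> \<open>Integrating H first over t gives Q, which is nonnegative; integrating first
      over x gives something nonpositive by \<open>form\<close>. Fubini squeezes the integral of Q
      over \<Omega> to 0.\<close>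
    define H where "H = (\<lambda>(x, t). indicator \<Omega> x * (indicator {0..T} t * ((T - t) * (Y x t \<bullet> V x t))))"
    have Hm: "H \<in> borel_measurable (lborel \<Otimes>\<^sub>M lborel)" unfolding H_def by measurable
    have Hi: "integrable (lborel \<Otimes>\<^sub>M lborel) H"
    proof (rule Bochner_Integration.integrable_bound[OF _ Hm])
      have "emeasure (lborel \<Otimes>\<^sub>M lborel) (\<Omega> \<times> {0..T}) = emeasure lborel \<Omega> * emeasure lborel {0..T}"
        by (rule lborel.emeasure_pair_measure_Times) auto
      also have "\<dots> < \<infinity>"
        using emeasure_bounded_finite[OF \<Omega>(2)] T by (simp add: ennreal_mult_less_top)
      finally have "emeasure (lborel \<Otimes>\<^sub>M lborel) (\<Omega> \<times> {0..T}) < \<infinity>" .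
      then show "integrable (lborel \<Otimes>\<^sub>M lborel) (\<lambda>p. indicator (\<Omega> \<times> {0..T}) p * (T * (M * C)))"
        by (intro integrable_mult_left integrable_real_indicator) auto
      have "norm (H (x, t)) \<le> norm (indicator (\<Omega> \<times> {0..T}) (x, t) * (T * (M * C)))" for x t
      proof (cases "x \<in> \<Omega> \<and> t \<in> {0..T}")
        case True
        have "\<bar>Y x t \<bullet> V x t\<bar> \<le> norm (Y x t) * norm (V x t)" by (rule Cauchy_Schwarz_ineq2)
        also have "\<dots> \<le> M * C" using M VC True M0 by (intro mult_mono) auto
        finally have "\<bar>T - t\<bar> * \<bar>Y x t \<bullet> V x t\<bar> \<le> T * (M * C)" using True T by (intro mult_mono) auto
        moreover have "C \<ge> 0" using M0 \<rho> by (simp add: C_def)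
        ultimately show ?thesis using True M0 T by (simp add: H_def abs_mult)
      qed (auto simp: H_def)
      then show "AE p in lborel \<Otimes>\<^sub>M lborel. norm (H p) \<le> norm (indicator (\<Omega> \<times> {0..T}) p * (T * (M * C)))"
        by (intro AE_I2) (metis surj_pair)
    qed
    have Hi': "integrable (lborel \<Otimes>\<^sub>M lborel) (case_prod (\<lambda>x t. H (x, t)))" using Hi by simp
    have HQ: "(LINT t|lborel. H (x, t)) = indicator \<Omega> x * Q x" for x
      by (simp add: H_def Q_def weighted_form_def V_def Abel_op_def set_lebesgue_integral_def)
    have Ht: "(LINT x|lborel. H (x, t)) \<le> 0" for t
    proof -
      have "(LINT x|lborel. H (x, t)) = indicator {0..T} t * ((T - t) * (LINT x|lborel. indicator \<Omega> x *\<^sub>R (Y x t \<bullet> V x t)))"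
        unfolding integral_mult_right_zero[symmetric] H_def
        by (intro Bochner_Integration.integral_cong) (auto simp: indicator_def)
      also have "\<dots> \<le> 0"
      proof (cases "t \<in> {0..T}")
        case True
        have "(LINT x|lborel. indicator \<Omega> x *\<^sub>R (Y x t \<bullet> V x t)) \<le> 0"
        proof (cases "t = 0")
          case True
          \<comment> \<open>\<open>form\<close> requires t > 0; at t = 0 the bound contains 0 powr
            \<rho> = 0, so V itself vanishes.\<close>
          have "norm (V x 0) \<le> M * (0 powr \<rho> / \<rho>)" for x
            unfolding V_def using M T \<rho> by (intro norm_Abel_op_le) auto
          then show ?thesis using True by simp
        next
          case False
          then show ?thesis using form[of t] \<open>t \<in> {0..T}\<close> by (simp add: set_lebesgue_integral_def)
        qed
        then show ?thesis using True by (auto simp: mult_le_0_iff)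
      qed simp
      finally show ?thesis .
    qed
    have iQ: "integrable lborel (\<lambda>x. indicator \<Omega> x * Q x)"
      using lborel_pair.integrable_fst[OF Hi'] unfolding HQ .
    have "(LINT x|lborel. indicator \<Omega> x * Q x) = (LINT t|lborel. LINT x|lborel. H (x, t))"
      using lborel_pair.Fubini_integral[OF Hi'] unfolding HQ by simp
    also have "\<dots> \<le> 0"
      using Bochner_Integration.integral_nonneg[of lborel "\<lambda>t. - (LINT x|lborel. H (x, t))"] Ht by simp
    finally have "(LINT x|lborel. indicator \<Omega> x * Q x) \<le> 0" .
    moreover have "(LINT x|lborel. indicator \<Omega> x * Q x) \<ge> 0" using Qp(1) by simp
    ultimately have "(LINT x|lborel. indicator \<Omega> x * Q x) = 0" by simp
    then have "AE x in lborel. indicator \<Omega> x * Q x = 0"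
      using integral_nonneg_eq_0_iff_AE[OF iQ] Qp(1) by simp
    then have "AE x in lborel. x \<in> \<Omega> \<longrightarrow> Y x t = 0"
      by eventually_elim (use Qp(2) T(2) in auto)
    \<comment> \<open>Continuity of Y in x on the open set \<Omega> removes the exceptional null
      set.\<close>
    then show ?thesis
      by (rule AE_eq_0_imp_eq_0_on_open[OF \<Omega>(1) continuous_on_subset[OF YK \<Omega>K] _ that(1)])
  qed
  \<comment> \<open>Y vanishes on all of [0,t], so the bound for \<open>Abel_op\<close> holds with
    constant 0. By \<open>inc\<close>, every integral of w over [\<epsilon>,t] is then 0.\<close>
  have V_zero: "V x t = 0" if "x \<in> \<Omega>" "0 \<le> t" for x t
    using norm_Abel_op_le[OF \<rho>(1) that(2), of "Y x" 0] Y_zero[OF that(1)] by (simp add: V_def)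
  have xK: "x \<in> K" using xt \<Omega>K by auto
  show ?thesis
  proof (rule integral_eq_0_imp_0[OF wc[OF xK] _ xt(2)])
    show "integral {\<epsilon>..t} (w x) = 0" if "0 < \<epsilon>" "\<epsilon> \<le> t" for \<epsilon> t
      using inc[OF xK that] V_zero[OF xt(1)] that G0 by simp
  qed
qed

theorem theorem1p2:
  fixes \<Omega> :: "(real, 'n::{finite,linorder}) vec set"
    and \<rho> :: real
    and l :: nat
    and a :: "('n \<Rightarrow> nat) \<Rightarrow> (real, 'n) vec \<Rightarrow> complex"
    and mj :: "nat \<Rightarrow> nat"
    and b :: "nat \<Rightarrow> ('n \<Rightarrow> nat) \<Rightarrow> (real, 'n) vec \<Rightarrow> complex"
    and f :: "(real, 'n) vec \<Rightarrow> real \<Rightarrow> complex"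
    and \<phi> :: "(real, 'n) vec \<Rightarrow> complex"
    and u v :: "(real, 'n) vec \<Rightarrow> real \<Rightarrow> complex"
  assumes "0 < \<rho>" and "\<rho> \<le> 1"
    and "open \<Omega>" and "connected \<Omega>" and "bounded \<Omega>" and "\<Omega> \<noteq> {}"
    and "1 \<le> l"
    and "\<And>j. j \<in> {1..l} \<Longrightarrow> mj j \<le> 2 * l - 1"
    and "positive_formally_selfadjoint \<Omega> (2 * l) a"
    and "condition_A \<Omega> l a mj b"
    and "continuous_on (closure \<Omega> \<times> {0<..}) (\<lambda>(x, t). f x t)"
    and "continuous_on (closure \<Omega>) \<phi>"
    and "regular_solution \<rho> \<Omega> l a mj b f \<phi> u"
    and "regular_solution \<rho> \<Omega> l a mj b f \<phi> v"
  shows "\<forall>x\<in>closure \<Omega>. \<forall>t>0. u x t = v x t"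
proof (intro ballI allI impI)
  fix x t assume x: "x \<in> closure \<Omega>" and t: "(t::real) > 0"
  have mj: "mj j \<le> 2 * l" if "j \<in> {1..l}" for j using assms(8)[OF that] by simp
  have pos: "symmetric_positive \<Omega> l a mj b" using assms(10) by (simp add: condition_A_def)
  have w: "regular_solution \<rho> \<Omega> l a mj b (\<lambda>_ _. 0) (\<lambda>_. 0) (\<lambda>x t. u x t - v x t)"
    by (rule regular_solution_diff[OF assms(1-3) mj assms(13,14)])
  have "u x t - v x t = 0"
  \<comment> \<open>The energy argument gives equality inside \<Omega>; continuity in x carries it
    to the boundary.\<close>
  proof (rule continuous_constant_on_closure[OF _ _ x])
    show "continuous_on (closure \<Omega>) (\<lambda>x. u x t - v x t)"
      using continuous_on_slice[OF regular_solutionD(3)[OF w]] t by simp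
    show "u x t - v x t = 0" if "x \<in> \<Omega>" for x
      using homogeneous_solution_eq_0[OF assms(1-3,5) mj pos w that t] .
  qed
  then show "u x t = v x t" by simp
qed

end
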